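(* Let $\mathfrak A$ be a sequentially complete HTG and $\mu$ be a weakly exhaustive $\mathfrak A$-valued $\sigma$-content. Then there is a unique $\mathfrak A$-valued measure $\nu$ such that $D_\mu\subset D_\nu\subset\mathscr H[\mu]$ and $\mu=\nu|_{D_\mu}$. We have $D_\mu\subset\mathcal S_{\mathfrak A}[\mu]\subset D_\nu$.
   Context: Groups are Abelian and written additively. An HTG is a group with a Hausdorff topology making addition and inversion continuous; it carries its canonical group uniformity, with respect to which (sequential) completeness is understood. For a map $f$, $D_f$ denotes its domain. "Countable" includes finite and empty. A ring (of sets) is a nonempty set $\mathcal Q$ of sets such that $A\cup B\in\mathcal Q$ and $A\setminus B\in\mathcal Q$ for all $A,B\in\mathcal Q$. A $\delta$-ring is a ring closed under intersections of nonempty countable families; a $\sigma$-ring is a ring closed under countable unions. For a set of sets $\mathcal K$, $\sigma(\mathcal K)$ is the smallest $\sigma$-ring containing $\mathcal K$, and $\sigma_0(\mathcal K)$ is the set of all countable unions of elements of $\mathcal K$. A family $\mathbf A\colon I\to\mathcal Q$ is disjoint if $\mathbf A(i)\cap\mathbf A(j)=\varnothing$ for $i\ne j$; it is a partition of $A$ (into elements of $\mathcal Q$) if it is disjoint and $\bigcup_{i\in I}\mathbf A(i)=A$ (members may be empty and $I$ may be empty); it is countable if $I$ is countable. A family $f\colon I\to\mathfrak A$ is summable in $\mathfrak A$ if the net $J\mapsto\sum_{i\in J}f(i)$ over the finite subsets $J\subset I$, directed by inclusion, converges in $\mathfrak A$; its limit is denoted $\sum f$. An $\mathfrak A$-valued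 map $\mu$ (defined on a set of sets $D_\mu$) is $\sigma$-additive if for every $A\in D_\mu$ and every countable partition $\mathbf A$ of $A$ into elements of $D_\mu$, the family $\mu\circ\mathbf A$ is summable in $\mathfrak A$ and $\mu(A)=\sum\mu\circ\mathbf A$. An $\mathfrak A$-valued $\sigma$-content (premeasure) is a $\sigma$-additive $\mathfrak A$-valued map whose domain is a ring (resp., a $\delta$-ring). The host $\sigma$-ring of a map $\mu$ is $\mathscr H[\mu]=\sigma(D_\mu)$. Maps $\mu,\nu$ are similar, $\mu\asymp\nu$, if $\mathscr H[\mu]=\mathscr H[\nu]$ and $\mu,\nu$ coincide on $D_\mu\cap D_\nu$. An $\mathfrak A$-valued measure is an $\mathfrak A$-valued premeasure $\mu$ which is an extension of every $\mathfrak A$-valued premeasure $\nu$ with $\nu\asymp\mu$. Given a set $A$, an $\mathfrak A$-valued map $\mu$ is $A$-exhaustive if $\mu(\mathbf A(n))\to0$ as $n\to\infty$ whenever $\mathbf A\colon\mathbb N\to D_\mu$ is a disjoint family with $\mathbf A(n)\subset A$ for every $n\in\mathbb N$. It is weakly exhaustive if it is $A$-exhaustive for every $A\in D_\mu$. Define $$\mathcal S_{\mathfrak A}[\mu]=\{B\in\mathscr H[\mu]: B\subset A\text{ for some }A\in\sigma_0(D_\mu)\text{ such that }\mu\text{ is }A\text{-exhaustive}\}.$$ *)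

theory Defs
  imports "HOL-Analysis.Analysis"
begin

text \<open>
  A Hausdorff topological Abelian group is a type of sort
  \<open>{topological_ab_group_add, uniform_topological_group_add, t2_space}\<close>. The class
  \<open>uniform_topological_group_add\<close> adds no freedom: it forces the uniformity to be the canonical
  group uniformity \<open>filtercomap (\<lambda>(x, y). y - x) (nhds 0)\<close> (see \<open>cauchy_seq_finset_iff_vanishing\<close>), and
  \<open>Cauchy\<close> refers to that uniformity.

  A map defined on a set of sets is a partial function \<open>'b set \<rightharpoonup> 'a\<close>, with domain \<open>dom \<mu>\<close>.
\<close>

definition sequentially_complete ::
    "'a::{topological_ab_group_add, uniform_topological_group_add, t2_space} itself \<Rightarrow> bool" where
  "sequentially_complete _ \<longleftrightarrow> (\<forall>X :: nat \<Rightarrow> 'a. Cauchy X \<longrightarrow> convergent X)"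

text \<open>
  A ring of sets is \<open>ring_of_sets UNIV\<close>: the bounding space plays no role, and \<open>{} \<in> \<Q>\<close>
  replaces \<open>\<Q> \<noteq> {}\<close> because \<open>{} = A - A\<close>.
\<close>

lemma ring_of_sets_UNIV_iff:
  "ring_of_sets UNIV \<Q> \<longleftrightarrow> \<Q> \<noteq> {} \<and> (\<forall>A\<in>\<Q>. \<forall>B\<in>\<Q>. A \<union> B \<in> \<Q> \<and> A - B \<in> \<Q>)"
proof
  assume *: "\<Q> \<noteq> {} \<and> (\<forall>A\<in>\<Q>. \<forall>B\<in>\<Q>. A \<union> B \<in> \<Q> \<and> A - B \<in> \<Q>)"
  then have "{} \<in> \<Q>"
    by (metis Diff_cancel ex_in_conv)
  with * show "ring_of_sets UNIV \<Q>"
    by (auto simp: ring_of_sets_iff)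
qed (auto simp: ring_of_sets_iff)

definition delta_ring :: "'b set set \<Rightarrow> bool" where
  "delta_ring \<Q> \<longleftrightarrow> ring_of_sets UNIV \<Q> \<and>
     (\<forall>\<C>. \<C> \<subseteq> \<Q> \<and> countable \<C> \<and> \<C> \<noteq> {} \<longrightarrow> \<Inter>\<C> \<in> \<Q>)"

definition sigma_ring :: "'b set set \<Rightarrow> bool" where
  "sigma_ring \<Q> \<longleftrightarrow> ring_of_sets UNIV \<Q> \<and>
     (\<forall>\<C>. \<C> \<subseteq> \<Q> \<and> countable \<C> \<longrightarrow> \<Union>\<C> \<in> \<Q>)"

definition countable_unions :: "'b set set \<Rightarrow> 'b set set" where
  "countable_unions \<K> = {\<Union>\<C> | \<C>. \<C> \<subseteq> \<K> \<and> countable \<C>}"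

text \<open>
  Countable index sets are taken to be subsets \<open>I\<close> of \<open>nat\<close>, without loss of generality since
  unordered summation is invariant under reindexing. As the group is Hausdorff, \<open>has_sum\<close> says
  both that the family is summable and that its sum is the given value.
\<close>

definition sigma_additive ::
    "('b set \<rightharpoonup> 'a::{topological_ab_group_add, t2_space}) \<Rightarrow> bool" where
  "sigma_additive \<mu> \<longleftrightarrow>
     (\<forall>A\<in>dom \<mu>. \<forall>(I :: nat set) (P :: nat \<Rightarrow> 'b set).
        P ` I \<subseteq> dom \<mu> \<and> disjoint_family_on P I \<and> (\<Union>i\<in>I. P i) = A \<longrightarrow>
        ((\<lambda>i. the (\<mu> (P i))) has_sum the (\<mu> A)) I)"

definition sigma_content ::
    "('b set \<rightharpoonup> 'a::{topological_ab_group_add, t2_space}) \<Rightarrow> bool" where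
  "sigma_content \<mu> \<longleftrightarrow> sigma_additive \<mu> \<and> ring_of_sets UNIV (dom \<mu>)"

definition premeasure ::
    "('b set \<rightharpoonup> 'a::{topological_ab_group_add, t2_space}) \<Rightarrow> bool" where
  "premeasure \<mu> \<longleftrightarrow> sigma_additive \<mu> \<and> delta_ring (dom \<mu>)"

definition host :: "('b set \<rightharpoonup> 'a) \<Rightarrow> 'b set set" where
  "host \<mu> = sigma_ring hull (dom \<mu>)"

definition similar :: "('b set \<rightharpoonup> 'a) \<Rightarrow> ('b set \<rightharpoonup> 'a) \<Rightarrow> bool" (infix \<open>\<asymp>\<close> 50) where
  "\<mu> \<asymp> \<nu> \<longleftrightarrow> host \<mu> = host \<nu> \<and> (\<forall>A \<in> dom \<mu> \<inter> dom \<nu>. \<mu> A = \<nu> A)"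

definition group_measure ::
    "('b set \<rightharpoonup> 'a::{topological_ab_group_add, t2_space}) \<Rightarrow> bool" where
  "group_measure \<mu> \<longleftrightarrow> premeasure \<mu> \<and> (\<forall>\<nu>. premeasure \<nu> \<and> \<nu> \<asymp> \<mu> \<longrightarrow> \<nu> \<subseteq>\<^sub>m \<mu>)"

definition exhaustive_on ::
    "'b set \<Rightarrow> ('b set \<rightharpoonup> 'a::{topological_ab_group_add, t2_space}) \<Rightarrow> bool" where
  "exhaustive_on A \<mu> \<longleftrightarrow>
     (\<forall>P :: nat \<Rightarrow> 'b set. range P \<subseteq> dom \<mu> \<and> disjoint_family P \<and> (\<forall>n. P n \<subseteq> A) \<longrightarrow>
        (\<lambda>n. the (\<mu> (P n))) \<longlonglongrightarrow> 0)"

definition weakly_exhaustive ::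
    "('b set \<rightharpoonup> 'a::{topological_ab_group_add, t2_space}) \<Rightarrow> bool" where
  "weakly_exhaustive \<mu> \<longleftrightarrow> (\<forall>A\<in>dom \<mu>. exhaustive_on A \<mu>)"

definition exhaustive_sets ::
    "('b set \<rightharpoonup> 'a::{topological_ab_group_add, t2_space}) \<Rightarrow> 'b set set" where
  "exhaustive_sets \<mu> =
     {B \<in> host \<mu>. \<exists>A \<in> countable_unions (dom \<mu>). B \<subseteq> A \<and> exhaustive_on A \<mu>}"

definition measure_extension ::
    "('b set \<rightharpoonup> 'a::{topological_ab_group_add, t2_space}) \<Rightarrow> ('b set \<rightharpoonup> 'a) \<Rightarrow> bool" where
  "measure_extension \<mu> \<nu> \<longleftrightarrow>
     group_measure \<nu> \<and> dom \<mu> \<subseteq> dom \<nu> \<and> dom \<nu> \<subseteq> host \<mu> \<and> \<mu> = \<nu> |` dom \<mu>"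

end

theory Submission
  imports Defs
begin

text \<open>
  Let \<open>\<mu>\<close> be \<open>A\<close>-exhaustive, where \<open>A\<close> is a countable union of sets of the ring \<open>dom \<mu>\<close>. Call a set
  \<open>U\<close>-small if it is covered by a countable union of ring elements on whose ring subsets \<open>\<mu>\<close> takes
  values in \<open>U\<close>. By exhaustivity the tails of a countable union are small, so every set in the
  generated \<open>\<sigma>\<close>-algebra on \<open>A\<close> is the limit of ring elements, and \<open>\<mu>\<close> is uniformly continuous for
  this topology. Its extension by continuity would a priori take values in a completion of the
  group; but the sets at which the limit lies in the group itself form a Dynkin system, because
  the group is sequentially complete.

  For premeasures, the domain is an ideal of the host \<open>\<sigma>\<close>-ring. Two \<open>\<sigma>\<close>-additive maps on ideals which
  agree on the intersection have a common \<open>\<sigma>\<close>-additive extension to the ideal generated by both, so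
  similar premeasures can be glued; the union of all premeasures similar to a given one is a measure.
  The same gluing shows that every set of \<open>exhaustive_sets \<mu>\<close> lies in the domain of that measure.
\<close>

subsection \<open>Neighbourhoods of zero\<close>

definition zero_nbhd :: "'a::{topological_space,zero} set \<Rightarrow> bool" where
  "zero_nbhd U \<longleftrightarrow> (\<forall>\<^sub>F x in nhds 0. x \<in> U)"

lemma zero_nbhd_mem: "zero_nbhd U \<Longrightarrow> 0 \<in> U"
  unfolding zero_nbhd_def by (rule eventually_nhds_x_imp_x)

lemma zero_nbhd_diff:
  fixes U :: "'a::topological_ab_group_add set"
  assumes "zero_nbhd U"
  obtains W where "zero_nbhd W" "\<And>x y. x \<in> W \<Longrightarrow> y \<in> W \<Longrightarrow> x - y \<in> U"
proof -
  have "((\<lambda>p. fst p - snd p) \<longlongrightarrow> (0::'a) - 0) (nhds 0 \<times>\<^sub>F nhds 0)"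
    by (intro tendsto_diff filterlim_fst filterlim_snd)
  then have "\<forall>\<^sub>F p in nhds 0 \<times>\<^sub>F nhds 0. fst p - snd p \<in> U"
    using assms unfolding zero_nbhd_def by (auto simp: filterlim_iff)
  then obtain Q where "eventually Q (nhds 0)" "\<And>x y. Q x \<Longrightarrow> Q y \<Longrightarrow> x - y \<in> U"
    unfolding eventually_prod_same by auto
  then show ?thesis
    by (intro that[of "Collect Q"]) (auto simp: zero_nbhd_def)
qed

text \<open>\<open>quarter W U\<close> is the additive analogue of an \<open>\<epsilon>/4\<close> choice.\<close>

definition quarter :: "'a::topological_ab_group_add set \<Rightarrow> 'a set \<Rightarrow> bool" where
  "quarter W U \<longleftrightarrow> zero_nbhd W \<and> (\<forall>x\<in>W. - x \<in> W) \<and>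
     (\<forall>a\<in>W. \<forall>b\<in>W. \<forall>c\<in>W. \<forall>d\<in>W. a + b + c + d \<in> U)"

lemma quarterD:
  assumes "quarter W U"
  shows "zero_nbhd W" "0 \<in> W" "x \<in> W \<Longrightarrow> - x \<in> W" "W \<subseteq> U"
    "a \<in> W \<Longrightarrow> b \<in> W \<Longrightarrow> a + b \<in> U"
    "a \<in> W \<Longrightarrow> b \<in> W \<Longrightarrow> c \<in> W \<Longrightarrow> a + b + c \<in> U"
    "a \<in> W \<Longrightarrow> b \<in> W \<Longrightarrow> c \<in> W \<Longrightarrow> d \<in> W \<Longrightarrow> a + b + c + d \<in> U"
proof -
  show 0: "zero_nbhd W" "0 \<in> W"
    using assms zero_nbhd_mem unfolding quarter_def by auto
  show 4: "a \<in> W \<Longrightarrow> b \<in> W \<Longrightarrow> c \<in> W \<Longrightarrow> d \<in> W \<Longrightarrow> a + b + c + d \<in> U" for a b c d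
    using assms unfolding quarter_def by blast
  show "x \<in> W \<Longrightarrow> - x \<in> W"
    using assms unfolding quarter_def by blast
  show "W \<subseteq> U" using 4[OF _ 0(2) 0(2) 0(2)] by auto
  show "a \<in> W \<Longrightarrow> b \<in> W \<Longrightarrow> a + b \<in> U" using 4[OF _ _ 0(2) 0(2)] by auto
  show "a \<in> W \<Longrightarrow> b \<in> W \<Longrightarrow> c \<in> W \<Longrightarrow> a + b + c \<in> U" using 4[OF _ _ _ 0(2)] by auto
qed

text \<open>Halving twice: \<open>a + b\<close> and \<open>- c - d\<close> are differences of
  elements of \<open>W\<close>, and their difference is the fourfold sum. Passing to the
  \<open>x\<close> in \<open>W\<close> with \<open>- x\<close> in \<open>W\<close> gives
  symmetry.\<close>

lemma quarter_exists:
  fixes U :: "'a::topological_ab_group_add set"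
  assumes "zero_nbhd U"
  obtains W where "quarter W U"
proof -
  obtain V where V: "zero_nbhd V" "\<And>x y. x \<in> V \<Longrightarrow> y \<in> V \<Longrightarrow> x - y \<in> U"
    using zero_nbhd_diff[OF assms] by blast
  obtain W where W: "zero_nbhd W" "\<And>x y. x \<in> W \<Longrightarrow> y \<in> W \<Longrightarrow> x - y \<in> V"
    using zero_nbhd_diff[OF V(1)] by blast
  let ?S = "{x. x \<in> W \<and> - x \<in> W}"
  have "((\<lambda>x::'a. - x) \<longlongrightarrow> - 0) (nhds 0)"
    by (intro tendsto_minus filterlim_ident)
  then have "\<forall>\<^sub>F x in nhds 0. - x \<in> W"
    using W(1) unfolding zero_nbhd_def by (auto simp: filterlim_iff)
  then have "zero_nbhd ?S"
    using W(1) unfolding zero_nbhd_def by (auto elim: eventually_elim2)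
  moreover have "a + b + c + d \<in> U" if "a \<in> ?S" "b \<in> ?S" "c \<in> ?S" "d \<in> ?S" for a b c d
  proof -
    have "a - (- b) \<in> V" "- c - d \<in> V"
      using W(2)[of a "-b"] W(2)[of "-c" d] that by auto
    moreover have "a + b + c + d = a - (- b) - (- c - d)"
      by (simp add: algebra_simps)
    ultimately show ?thesis
      using V(2) by metis
  qed
  ultimately show ?thesis
    by (intro that[of ?S]) (auto simp: quarter_def)
qed

text \<open>The group version of the errors \<epsilon>/2^n: in a chain where each set is a quarter
  of its predecessor, a finite sum collapses from its far end, one level at a time.\<close>

lemma quarter_sequence:
  fixes U :: "'a::topological_ab_group_add set"
  assumes "zero_nbhd U"
  obtains W where "\<And>n::nat. zero_nbhd (W n)"
    "\<And>N x. (\<And>i. i < N \<Longrightarrow> x i \<in> W i) \<Longrightarrow> sum x {..<N} \<in> U"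
proof -
  have "\<exists>f. \<forall>n::nat. (zero_nbhd (f n) \<and> (n = 0 \<longrightarrow> f n = U)) \<and> quarter (f (Suc n)) (f n)"
  proof (rule dependent_nat_choice)
    fix V :: "'a set" and n :: nat
    assume "zero_nbhd V \<and> (n = 0 \<longrightarrow> V = U)"
    then obtain W where "quarter W V" using quarter_exists by blast
    then show "\<exists>W. (zero_nbhd W \<and> (Suc n = 0 \<longrightarrow> W = U)) \<and> quarter W V"
      using quarterD(1) by blast
  qed (use assms in auto)
  then obtain f where f: "\<And>n. zero_nbhd (f n)" "f 0 = U" "\<And>n. quarter (f (Suc n)) (f n)"
    by (elim exE) (simp, blast)
  \<comment> \<open>Induction on the number \<open>n\<close> of final terms: \<open>x i\<close> and
    the sum beyond it both lie in \<open>f (Suc i)\<close>, hence together in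
    \<open>f i\<close>.\<close>
  have tail: "sum x {N - n..<N} \<in> f (N - n)" if "n \<le> N" "\<And>i. i < N \<Longrightarrow> x i \<in> f (Suc i)" for x n N
    using that
  proof (induction n)
    case 0
    have "0 \<in> f N" by (rule zero_nbhd_mem) (rule f)
    then show ?case by simp
  next
    case (Suc n)
    then have "sum x {N - n..<N} \<in> f (N - n)" by simp
    moreover have "x (N - Suc n) \<in> f (N - n)"
      using Suc.prems(2)[of "N - Suc n"] Suc.prems(1) by (simp add: Suc_diff_Suc)
    moreover have "quarter (f (N - n)) (f (N - Suc n))"
      using f(3)[of "N - Suc n"] Suc.prems(1) by (simp add: Suc_diff_Suc)
    moreover have "sum x {N - Suc n..<N} = x (N - Suc n) + sum x {N - n..<N}"
      using Suc.prems(1) by (subst sum.atLeast_Suc_lessThan) (auto simp: Suc_diff_Suc)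
    ultimately show ?case using quarterD(5) by metis
  qed
  show ?thesis
  proof (rule that[of "\<lambda>n. f (Suc n)"])
    show "zero_nbhd (f (Suc n))" for n by (rule f)
    show "sum x {..<N} \<in> U" if "\<And>i. i < N \<Longrightarrow> x i \<in> f (Suc i)" for N x
      using tail[of N N x] that f(2) by (simp add: atLeast0LessThan)
  qed
qed

lemma eq_zero_if_in_all_nbhds:
  fixes x :: "'a::{zero,t2_space}"
  assumes "\<And>U. zero_nbhd U \<Longrightarrow> x \<in> U"
  shows "x = 0"
proof (rule ccontr)
  assume "x \<noteq> 0"
  then obtain U where "open U" "0 \<in> U" "x \<notin> U"
    by (metis t1_space)
  then have "zero_nbhd U"
    unfolding zero_nbhd_def by (simp add: eventually_nhds_in_open)
  with assms \<open>x \<notin> U\<close> show False by blast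
qed

lemma tendsto_zero_nbhd_iff:
  fixes l :: "'a::topological_ab_group_add"
  shows "(f \<longlongrightarrow> l) F \<longleftrightarrow> (\<forall>U. zero_nbhd U \<longrightarrow> (\<forall>\<^sub>F x in F. f x - l \<in> U))"
proof -
  have "(f \<longlongrightarrow> l) F \<longleftrightarrow> ((\<lambda>x. f x - l) \<longlongrightarrow> 0) F"
    using tendsto_diff[OF _ tendsto_const[of l F], of f l]
      tendsto_add[OF _ tendsto_const[of l F], of "\<lambda>x. f x - l" 0] by auto
  also have "\<dots> \<longleftrightarrow> (\<forall>U. zero_nbhd U \<longrightarrow> (\<forall>\<^sub>F x in F. f x - l \<in> U))"
  proof safe
    fix U :: "'a set" assume "((\<lambda>x. f x - l) \<longlongrightarrow> 0) F" "zero_nbhd U"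
    then show "\<forall>\<^sub>F x in F. f x - l \<in> U"
      by (auto simp: filterlim_iff zero_nbhd_def dest!: spec[of _ "\<lambda>x. x \<in> U"])
  next
    assume *: "\<forall>U. zero_nbhd U \<longrightarrow> (\<forall>\<^sub>F x in F. f x - l \<in> U)"
    show "((\<lambda>x. f x - l) \<longlongrightarrow> 0) F"
      unfolding filterlim_iff
    proof safe
      fix Q :: "'a \<Rightarrow> bool" assume "eventually Q (nhds 0)"
      with *[rule_format, of "Collect Q"] show "\<forall>\<^sub>F x in F. Q (f x - l)"
        by (simp add: zero_nbhd_def)
    qed
  qed
  finally show ?thesis .
qed

text \<open>The uniformity is the canonical one of the group, so its entourages are given by
  differences in a neighbourhood of zero.\<close>

lemma convergent_if_sequentially_complete:
  fixes X :: "nat \<Rightarrow> 'a::{topological_ab_group_add, uniform_topological_group_add, t2_space}"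
  assumes "sequentially_complete TYPE('a)"
    and "\<And>U. zero_nbhd U \<Longrightarrow> \<exists>N. \<forall>i\<ge>N. \<forall>j\<ge>N. X i - X j \<in> U"
  shows "convergent X"
proof -
  have "Cauchy X"
    unfolding Cauchy_uniform_iff cauchy_seq_finset_iff_vanishing eventually_filtercomap
  proof safe
    fix P and Q :: "'a \<Rightarrow> bool"
    assume "eventually Q (nhds 0)" and Q: "\<forall>x. Q (case x of (x, y) \<Rightarrow> y - x) \<longrightarrow> P x"
    then have "zero_nbhd (Collect Q)" by (simp add: zero_nbhd_def)
    from assms(2)[OF this] Q show "\<exists>N. \<forall>n\<ge>N. \<forall>m\<ge>N. P (X n, X m)"
      by fastforce
  qed
  with assms(1) show ?thesis unfolding sequentially_complete_def by blast
qed

subsection \<open>Extension of an exhaustive content\<close>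

text \<open>The situation on one set \<open>A\<close>, with \<open>R\<close> as the trace of the
  ring: exhaustivity is unconditional, and \<open>A\<close> is the unit of a sigma-algebra without
  having to lie in \<open>R\<close>. Additivity is stated for ordered series; summability over
  finite subsets is recovered in \<open>extension\<close>.\<close>

locale exhaustive_content =
  fixes A :: "'b set" and R :: "'b set set"
    and m :: "'b set \<Rightarrow> 'a::{topological_ab_group_add, uniform_topological_group_add, t2_space}"
  assumes complete: "sequentially_complete TYPE('a)"
    and ring: "ring_of_sets A R"
    and countably_additive:
      "\<And>P :: nat \<Rightarrow> 'b set. range P \<subseteq> R \<Longrightarrow> disjoint_family P \<Longrightarrow> (\<Union>n. P n) \<in> R \<Longrightarrow>
         (\<lambda>n. m (P n)) sums m (\<Union>n. P n)"
    and exhaustive: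
      "\<And>P :: nat \<Rightarrow> 'b set. range P \<subseteq> R \<Longrightarrow> disjoint_family P \<Longrightarrow> (\<lambda>n. m (P n)) \<longlonglongrightarrow> 0"
    and sigma_finite: "\<exists>C :: nat \<Rightarrow> 'b set. range C \<subseteq> R \<and> (\<Union>n. C n) = A"
begin

sublocale ring_of_sets A R by (rule ring)

declare finite_UN [rule del] finite_Union [rule del] finite_INT [rule del]

section \<open>Elementary properties of the content\<close>

lemma m_empty [simp]: "m {} = 0"
proof -
  \<comment> \<open>The constant sequence of empty sets is disjoint, so exhaustivity forces its
    value to be 0.\<close>
  have "(\<lambda>n::nat. m {}) \<longlonglongrightarrow> 0"
    using exhaustive[of "\<lambda>_. {}"] by (auto simp: disjoint_family_on_def)
  then show ?thesis by (simp add: LIMSEQ_const_iff)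
qed

lemma m_Un:
  assumes "E \<in> R" "F \<in> R" "E \<inter> F = {}"
  shows "m (E \<union> F) = m E + m F"
proof -
  let ?P = "\<lambda>n::nat. if n = 0 then E else if n = 1 then F else {}"
  have un: "(\<Union>n. ?P n) = E \<union> F"
    by (auto split: if_splits)
  have "(\<lambda>n. m (?P n)) sums m (\<Union>n. ?P n)"
    using assms by (intro countably_additive) (auto simp: un disjoint_family_on_def)
  moreover have "(\<lambda>n. m (?P n)) sums (\<Sum>n\<in>{0,1}. m (?P n))"
    by (rule sums_finite) auto
  ultimately show ?thesis
    unfolding un using sums_unique2 by fastforce
qed

lemma m_split: "E \<in> R \<Longrightarrow> F \<in> R \<Longrightarrow> m E = m (E \<inter> F) + m (E - F)"
  using m_Un[of "E \<inter> F" "E - F"] by (auto simp: Int_Diff_Un)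

lemma m_UN:
  assumes "finite I" "\<And>i. i \<in> I \<Longrightarrow> P i \<in> R" "disjoint_family_on P I"
  shows "m (\<Union>i\<in>I. P i) = (\<Sum>i\<in>I. m (P i))"
  using assms
proof (induction I rule: finite_induct)
  case (insert j I)
  have "P j \<inter> (\<Union>i\<in>I. P i) = {}"
    using insert.prems(2) insert.hyps(2)
    unfolding disjoint_family_on_def Int_UN_distrib by auto
  moreover have dj: "disjoint_family_on P I"
    by (rule disjoint_family_on_mono[OF subset_insertI insert.prems(2)])
  moreover have "(\<Union>i\<in>I. P i) \<in> R"
    using insert by (intro finite_UN) auto
  ultimately show ?case
    using insert by (simp add: m_Un)
qed simp

text \<open>Telescoping along \<open>disjointed C\<close>. The union of the \<open>C n\<close> may
  lie outside \<open>R\<close>, so additivity is applied to \<open>F\<close> and its pieces.\<close>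

lemma m_continuous:
  assumes "range C \<subseteq> R" "F \<in> R" "F \<subseteq> (\<Union>n. C n)"
  shows "(\<lambda>n::nat. m (F \<inter> (\<Union>i<n. C i))) \<longlonglongrightarrow> m F"
proof -
  have D: "range (disjointed C) \<subseteq> R"
    using range_disjointed_sets[OF assms(1)] .
  have dj: "disjoint_family_on (\<lambda>i. F \<inter> disjointed C i) I" for I
    using disjoint_family_disjointed[of C] unfolding disjoint_family_on_def by blast
  have U: "(\<Union>i. F \<inter> disjointed C i) = F"
    using assms(3) UN_disjointed_eq[of C] by auto
  have "(\<lambda>n. m (F \<inter> disjointed C n)) sums m (\<Union>i. F \<inter> disjointed C i)"
    using D dj U assms(2) by (intro countably_additive) auto
  moreover have "(\<Sum>i<n. m (F \<inter> disjointed C i)) = m (F \<inter> (\<Union>i<n. C i))" for n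
    using D dj assms(2) finite_UN_disjointed_eq[of C n]
    by (subst m_UN[symmetric]) (auto simp: atLeast0LessThan intro!: arg_cong[of _ _ m])
  ultimately show ?thesis unfolding U sums_def by simp
qed

text \<open>\<open>E\<close> may contain too few ring sets to be tested itself, so the test runs
  over a countable cover from \<open>R\<close>, in the manner of an outer measure. This makes
  smallness hereditary.\<close>

definition small :: "'a set \<Rightarrow> 'b set \<Rightarrow> bool" where
  "small U E \<longleftrightarrow> (\<exists>C :: nat \<Rightarrow> 'b set. range C \<subseteq> R \<and> E \<subseteq> (\<Union>n. C n) \<and>
     (\<forall>F\<in>R. F \<subseteq> (\<Union>n. C n) \<longrightarrow> m F \<in> U))"

lemma smallD: "small U E \<Longrightarrow> F \<in> R \<Longrightarrow> F \<subseteq> E \<Longrightarrow> m F \<in> U"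
  unfolding small_def by blast

section \<open>Calculus of small sets\<close>

lemma small_mono: "small U E \<Longrightarrow> E' \<subseteq> E \<Longrightarrow> U \<subseteq> U' \<Longrightarrow> small U' E'"
  unfolding small_def by (elim exE) (rule exI, blast)

lemma small_empty: "0 \<in> U \<Longrightarrow> small U {}"
  unfolding small_def by (rule exI[of _ "\<lambda>_. {}"]) auto

text \<open>Countable subadditivity, with a sequence of tolerances in place of a convergent series.
  A ring set inside the union of all covers is cut to a finite stage and made disjoint; the pieces
  contribute a sum in \<open>V\<close>, and the passage to the limit costs one further error in
  \<open>Z\<close>.\<close>

lemma small_UN:
  assumes W: "\<And>n::nat. small (W n) (E n)"
    and sum: "\<And>N x. (\<And>i. i < N \<Longrightarrow> x i \<in> W i) \<Longrightarrow> sum x {..<N} \<in> V"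
    and Z: "zero_nbhd Z" and U: "\<And>x y. x \<in> V \<Longrightarrow> y \<in> Z \<Longrightarrow> x - y \<in> U"
  shows "small U (\<Union>n. E n)"
proof -
  have "\<exists>C. (\<forall>k::nat. C k \<in> R) \<and> E n \<subseteq> (\<Union>k. C k) \<and>
      (\<forall>F\<in>R. F \<subseteq> (\<Union>k. C k) \<longrightarrow> m F \<in> W n)" for n
    using W[of n] by (simp add: small_def image_subset_iff)
  then have "\<forall>n. \<exists>C. (\<forall>k::nat. C k \<in> R) \<and> E n \<subseteq> (\<Union>k. C k) \<and>
      (\<forall>F\<in>R. F \<subseteq> (\<Union>k. C k) \<longrightarrow> m F \<in> W n)" ..
  then obtain C where "\<forall>n. (\<forall>k::nat. C n k \<in> R) \<and> E n \<subseteq> (\<Union>k. C n k) \<and>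
      (\<forall>F\<in>R. F \<subseteq> (\<Union>k. C n k) \<longrightarrow> m F \<in> W n)"
    unfolding choice_iff ..
  then have C: "\<And>n k. C n k \<in> R" "\<And>n. E n \<subseteq> (\<Union>k. C n k)"
      "\<And>n F. F \<in> R \<Longrightarrow> F \<subseteq> (\<Union>k. C n k) \<Longrightarrow> m F \<in> W n"
    by simp_all
  \<comment> \<open>Square exhaustion of the double sequence of covers: each stage is a finite
    union, so it lies in \<open>R\<close>, and the stages increase to the full union.\<close>
  define D where "D N = (\<Union>n<N. \<Union>k<N. C n k)" for N
  have D: "range D \<subseteq> R"
    unfolding D_def by (intro image_subsetI finite_UN C(1) finite_lessThan)
  have D_mono: "D i \<subseteq> D N" if "i \<le> N" for i N
    unfolding D_def using that by (intro UN_mono) auto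
  have D_UN: "(\<Union>i<Suc N. D i) = D N" for N
  proof
    show "(\<Union>i<Suc N. D i) \<subseteq> D N"
      by (intro UN_least D_mono) simp
  qed (rule UN_upper, simp)
  have D_all: "(\<Union>N. D N) = (\<Union>n k. C n k)"
  proof
    show "(\<Union>n k. C n k) \<subseteq> (\<Union>N. D N)"
    proof safe
      fix x n k assume "x \<in> C n k"
      then have "x \<in> D (Suc (max n k))" unfolding D_def by (intro UN_I[of n] UN_I[of k]) auto
      then show "x \<in> (\<Union>N. D N)" by blast
    qed
  qed (unfold D_def, blast)
  have fin: "m (F \<inter> D N) \<in> V" if F: "F \<in> R" for F N
  proof -
    \<comment> \<open>Disjointing the rows gives one piece per index \<open>n < N\<close>, still
      inside the \<open>n\<close>-th cover; its value is therefore in \<open>W n\<close>.\<close>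
    define G where "G n = F \<inter> (\<Union>k<N. C n k)" for n
    have G: "range G \<subseteq> R"
      unfolding G_def by (intro image_subsetI Int F finite_UN C(1) finite_lessThan)
    have "F \<inter> D N = (\<Union>n<N. G n)"
      unfolding D_def G_def by blast
    also have "\<dots> = (\<Union>n<N. disjointed G n)"
      using finite_UN_disjointed_eq[of G N] by (simp add: atLeast0LessThan)
    also have "m \<dots> = (\<Sum>n<N. m (disjointed G n))"
      using range_disjointed_sets[OF G] disjoint_family_disjointed[of G]
      by (intro m_UN) (auto simp: disjoint_family_on_def)
    also have "\<dots> \<in> V"
    proof (rule sum)
      fix n
      have "disjointed G n \<subseteq> (\<Union>k. C n k)"
        using disjointed_subset[of G n] unfolding G_def by blast
      moreover have "disjointed G n \<in> R"
        using range_disjointed_sets[OF G] by blast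
      ultimately show "m (disjointed G n) \<in> W n" by (intro C(3))
    qed
    finally show ?thesis .
  qed
  have "m F \<in> U" if F: "F \<in> R" "F \<subseteq> (\<Union>N. D N)" for F
  proof -
    have "\<forall>\<^sub>F n in sequentially. m (F \<inter> (\<Union>i<n. D i)) - m F \<in> Z"
      using m_continuous[OF D F] Z unfolding tendsto_zero_nbhd_iff by blast
    then obtain N where "\<And>n. n \<ge> N \<Longrightarrow> m (F \<inter> (\<Union>i<n. D i)) - m F \<in> Z"
      unfolding eventually_sequentially by blast
    \<comment> \<open>The shift to \<open>Suc N\<close> makes the union over
      \<open>i < Suc N\<close> equal to the single stage \<open>D N\<close>.\<close>
    from this[of "Suc N"] have "m (F \<inter> D N) - m F \<in> Z" unfolding D_UN by simp
    from U[OF fin[OF F(1), of N] this] show ?thesis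
      by (simp add: algebra_simps)
  qed
  then show ?thesis
    unfolding small_def using D UN_mono[OF order_refl C(2)]
    by (intro exI[of _ D] conjI ballI impI) (simp_all add: D_all)
qed

lemma small_Un:
  assumes "quarter W U" "small W E" "small W F"
  shows "small U (E \<union> F)"
proof -
  note W = quarterD[OF assms(1)]
  \<comment> \<open>The two sets are padded by empty ones, which are small even for
    \<open>{0}\<close>, so all sums reduce to two terms. With the error of the limit, three elements
    of \<open>W\<close> are added, within the four that \<open>quarter\<close> allows.\<close>
  let ?W = "\<lambda>n::nat. if n < 2 then W else {0}"
  let ?E = "\<lambda>n::nat. if n = 0 then E else if n = 1 then F else {}"
  have "small U (\<Union>n. ?E n)"
  proof (rule small_UN)
    show "small (?W n) (?E n)" for n
      using assms by (auto intro: small_empty)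
    show "sum x {..<N} \<in> {a + b |a b. a \<in> W \<and> b \<in> W}" if "\<And>i. i < N \<Longrightarrow> x i \<in> ?W i" for N x
    proof -
      have "sum x {..<N} = (if 0 < N then x 0 else 0) + (if 1 < N then x 1 else 0)"
        using that
      proof (induction N)
        case (Suc N)
        then have "x N \<in> ?W N" by simp
        moreover have IH: "sum x {..<N} = (if 0 < N then x 0 else 0) + (if 1 < N then x 1 else 0)"
          by (rule Suc.IH) (use Suc.prems in simp)
        ultimately show ?case
          by (cases "N = 0"; cases "N = 1") (auto split: if_splits)
      qed simp
      moreover have "(if 0 < N then x 0 else 0) \<in> W" "(if 1 < N then x 1 else 0) \<in> W"
        using that[of 0] that[of 1] W(2) by auto
      ultimately show ?thesis by blast
    qed
    show "zero_nbhd W" by (rule W)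
    show "x - y \<in> U" if "x \<in> {a + b |a b. a \<in> W \<and> b \<in> W}" "y \<in> W" for x y
      using that W(3)[of y] W(6) by fastforce
  qed
  moreover have "(\<Union>n. ?E n) = E \<union> F"
    by (auto split: if_splits)
  ultimately show ?thesis by simp
qed

text \<open>Gliding hump: if no tail is small, then beyond every index there is a ring set with
  value outside \<open>W\<close> that ends at a finite stage. Infinitely many of these can be chosen
  disjoint, against exhaustivity.\<close>

lemma small_tail:
  assumes C: "range C \<subseteq> R" and U: "zero_nbhd U"
  shows "\<exists>N::nat. small U ((\<Union>n. C n) - (\<Union>i<N. C i))"
proof (rule ccontr)
  assume *: "\<not> (\<exists>N. small U ((\<Union>n. C n) - (\<Union>i<N. C i)))"
  obtain W where "quarter W U" using quarter_exists[OF U] .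
  note W = quarterD[OF this]
  \<comment> \<open>A set in the tail with value outside \<open>U\<close> may meet infinitely many
    \<open>C i\<close>. Continuity truncates it at a finite stage \<open>n\<close>, at the price of
    replacing \<open>U\<close> by \<open>W\<close>.\<close>
  have "\<exists>n F. F \<in> R \<and> F \<subseteq> (\<Union>i<n. C i) - (\<Union>i<N. C i) \<and> m F \<notin> W" for N
  proof -
    let ?D = "\<lambda>i. C i - (\<Union>i<N. C i)"
    have D: "range ?D \<subseteq> R" "(\<Union>n. C n) - (\<Union>i<N. C i) \<subseteq> (\<Union>n. ?D n)"
    proof -
      show "range ?D \<subseteq> R"
        using C by (intro image_subsetI Diff finite_UN) auto
    qed blast
    have "\<exists>F\<in>R. F \<subseteq> (\<Union>n. ?D n) \<and> m F \<notin> U"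
    proof (rule ccontr)
      assume "\<not> ?thesis"
      with D have "small U ((\<Union>n. C n) - (\<Union>i<N. C i))"
        unfolding small_def by (intro exI[of _ ?D]) auto
      with * show False by blast
    qed
    then obtain F where F: "F \<in> R" "F \<subseteq> (\<Union>n. ?D n)" "m F \<notin> U" by blast
    have "\<forall>\<^sub>F n in sequentially. m (F \<inter> (\<Union>i<n. ?D i)) - m F \<in> W"
      using m_continuous[OF D(1) F(1,2)] W(1) unfolding tendsto_zero_nbhd_iff by blast
    then obtain n where n: "m (F \<inter> (\<Union>i<n. ?D i)) - m F \<in> W"
      unfolding eventually_sequentially by blast
    have "m (F \<inter> (\<Union>i<n. ?D i)) \<notin> W"
    proof
      assume "m (F \<inter> (\<Union>i<n. ?D i)) \<in> W"
      from W(5)[OF this W(3)[OF n]] F(3) show False by simp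
    qed
    moreover have "F \<inter> (\<Union>i<n. ?D i) \<in> R"
      using D(1) F(1) by (intro Int finite_UN) (simp_all add: image_subset_iff)
    moreover have "F \<inter> (\<Union>i<n. ?D i) \<subseteq> (\<Union>i<n. C i) - (\<Union>i<N. C i)" by blast
    ultimately show ?thesis by blast
  qed
  then obtain n F where F: "\<And>N. F N \<in> R" "\<And>N. F N \<subseteq> (\<Union>i<n N. C i) - (\<Union>i<N. C i)" "\<And>N. m (F N) \<notin> W"
    by metis
  \<comment> \<open>\<open>s (Suc k)\<close> is at least the stage where the set chosen at
    \<open>s k\<close> ends, so the set chosen at \<open>s (Suc k)\<close> avoids it;
    \<open>max\<close> keeps \<open>s\<close> monotone.\<close>
  define s where "s = rec_nat 0 (\<lambda>_ k. max k (n k))"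
  have s: "s (Suc k) = max (s k) (n (s k))" for k
    unfolding s_def by simp
  have s_mono: "mono s" by (rule incseq_SucI) (simp add: s)
  have disj: "F (s i) \<inter> F (s j) = {}" if "i < j" for i j
  proof -
    have "n (s i) \<le> s j"
      using monoD[OF s_mono, of "Suc i" j] that s[of i] by simp
    then have "(\<Union>k<n (s i). C k) \<subseteq> (\<Union>k<s j. C k)" by (intro UN_mono) simp_all
    moreover have "F (s i) \<subseteq> (\<Union>k<n (s i). C k)" "F (s j) \<inter> (\<Union>k<s j. C k) = {}"
      using F(2)[of "s i"] F(2)[of "s j"] by blast+
    ultimately show ?thesis by (meson disjoint_iff subsetD)
  qed
  have "disjoint_family (\<lambda>k. F (s k))"
    unfolding disjoint_family_on_def using disj by (metis Int_commute linorder_neqE_nat)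
  then have "(\<lambda>k. m (F (s k))) \<longlonglongrightarrow> 0"
    using F(1) by (intro exhaustive) auto
  then have "\<forall>\<^sub>F k in sequentially. m (F (s k)) \<in> W"
    using W(1) unfolding tendsto_zero_nbhd_iff by auto
  then show False using F(3) by simp
qed

text \<open>\<open>val E g\<close> says that \<open>m F\<close> tends to \<open>g\<close> as \<open>F\<close> tends to \<open>E\<close>. Asking for one good \<open>F\<close> per
  neighbourhood suffices, as \<open>m\<close> is uniformly continuous (compare \<open>val_unique\<close>).\<close>

definition val :: "'b set \<Rightarrow> 'a \<Rightarrow> bool" where
  "val E g \<longleftrightarrow> (\<forall>U. zero_nbhd U \<longrightarrow> (\<exists>F\<in>R. small U (sym_diff E F) \<and> m F - g \<in> U))"

section \<open>Calculus of limit values\<close>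

lemma val_ring: "E \<in> R \<Longrightarrow> val E (m E)"
  unfolding val_def by (intro allI impI bexI[of _ E]) (simp_all add: small_empty zero_nbhd_mem)

text \<open>Continuity of limit values at the empty set: an approximant of a small set is covered by
  that set and the symmetric difference, hence is small too, and \<open>g\<close> differs little
  from its value.\<close>

lemma val_small:
  assumes "zero_nbhd U"
  obtains W where "quarter W U" "\<And>E g. small W E \<Longrightarrow> val E g \<Longrightarrow> g \<in> U"
proof -
  obtain V where "quarter V U" using quarter_exists[OF assms] .
  note V = quarterD[OF this]
  obtain W where W0: "quarter W V" using quarter_exists[OF V(1)] .
  note W = quarterD[OF this]
  show ?thesis
  proof (rule that[of W])
    show "quarter W U"
      using W0 V(4) unfolding quarter_def by blast
    fix E g assume E: "small W E" "val E g"
    then obtain F where F: "F \<in> R" "small W (sym_diff E F)" "m F - g \<in> W"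
      unfolding val_def using W(1) by blast
    have "small V F"
      by (rule small_mono[OF small_Un[OF W0 E(1) F(2)]]) auto
    then have "m F \<in> V" using F(1) smallD by blast
    moreover have "- (m F - g) \<in> V" using W(3)[OF F(3)] W(4) by blast
    ultimately show "g \<in> U" using V(5) by fastforce
  qed
qed

text \<open>Approximants of nested sets need not be nested. The defect \<open>F' - F\<close> lies in
  the two symmetric differences, so its value is a small correction in the identity for
  \<open>m (F - F')\<close>.\<close>

lemma val_Diff:
  assumes "val E g" "val E' g'" "E' \<subseteq> E"
  shows "val (E - E') (g - g')"
  unfolding val_def
proof safe
  fix U :: "'a set" assume "zero_nbhd U"
  then obtain V where V0: "quarter V U" using quarter_exists by blast
  note V = quarterD[OF V0]
  obtain W where W0: "quarter W V" using quarter_exists[OF V(1)] .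
  note W = quarterD[OF this]
  obtain F where F: "F \<in> R" "small W (sym_diff E F)" "m F - g \<in> W"
    using assms(1) W(1) unfolding val_def by blast
  obtain F' where F': "F' \<in> R" "small W (sym_diff E' F')" "m F' - g' \<in> W"
    using assms(2) W(1) unfolding val_def by blast
  have sm: "small V (sym_diff E F \<union> sym_diff E' F')" by (rule small_Un[OF W0 F(2) F'(2)])
  have "m (F' - F) \<in> V"
    by (rule smallD[OF sm]) (use F F' assms(3) in auto)
  moreover have "m (F - F') - (g - g') = (m F - g) + - (m F' - g') + m (F' - F)"
    using m_split[OF F(1) F'(1)] m_split[OF F'(1) F(1)] by (simp add: Int_commute)
  ultimately have "m (F - F') - (g - g') \<in> U"
    using V(6)[OF _ _ \<open>m (F' - F) \<in> V\<close>] W(4) F(3) W(3)[OF F'(3)] by (metis subsetD)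
  moreover have "small U (sym_diff (E - E') (F - F'))"
    by (rule small_mono[OF sm _ V(4)]) auto
  ultimately show "\<exists>F\<in>R. small U (sym_diff (E - E') F) \<and> m F - (g - g') \<in> U"
    using F(1) F'(1) by blast
qed

text \<open>The difference of two values is a value of the empty set, which is small for every
  neighbourhood; the Hausdorff property does the rest.\<close>

lemma val_unique:
  assumes "val E g" "val E g'"
  shows "g = g'"
proof -
  have v: "val {} (g - g')" using val_Diff[OF assms] by simp
  have "g - g' \<in> U" if U: "zero_nbhd U" for U
    using val_small[OF U] v small_empty quarterD(2) by metis
  then show ?thesis using eq_zero_if_in_all_nbhds by fastforce
qed

lemma val_Un:
  assumes "val E g" "val E' g'" "E \<inter> E' = {}"
  shows "val (E \<union> E') (g + g')"
  unfolding val_def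
proof safe
  fix U :: "'a set" assume "zero_nbhd U"
  then obtain V where V0: "quarter V U" using quarter_exists by blast
  note V = quarterD[OF V0]
  obtain W where W0: "quarter W V" using quarter_exists[OF V(1)] .
  note W = quarterD[OF this]
  obtain F where F: "F \<in> R" "small W (sym_diff E F)" "m F - g \<in> W"
    using assms(1) W(1) unfolding val_def by blast
  obtain F' where F': "F' \<in> R" "small W (sym_diff E' F')" "m F' - g' \<in> W"
    using assms(2) W(1) unfolding val_def by blast
  have sm: "small V (sym_diff E F \<union> sym_diff E' F')" by (rule small_Un[OF W0 F(2) F'(2)])
  \<comment> \<open>Approximants of disjoint sets may overlap, but only inside the symmetric
    differences.\<close>
  have i: "m (F' \<inter> F) \<in> V"
    by (rule smallD[OF sm]) (use F F' assms(3) in auto)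
  have "m (F \<union> F') - (g + g') = (m F - g) + (m F' - g') + - m (F' \<inter> F)"
    using m_split[OF F'(1) F(1)] m_Un[OF F(1) Diff[OF F'(1) F(1)]] by (simp add: algebra_simps)
  then have "m (F \<union> F') - (g + g') \<in> U"
    using V(6)[OF _ _ V(3)[OF i]] W(4) F(3) F'(3) by (metis subsetD)
  moreover have "small U (sym_diff (E \<union> E') (F \<union> F'))"
    by (rule small_mono[OF sm _ V(4)]) auto
  ultimately show "\<exists>F\<in>R. small U (sym_diff (E \<union> E') F) \<and> m F - (g + g') \<in> U"
    using F(1) F'(1) by blast
qed

lemma val_finite_UN:
  assumes "finite I" "\<And>i. i \<in> I \<Longrightarrow> val (P i) (g i)" "disjoint_family_on P I"
  shows "val (\<Union>i\<in>I. P i) (\<Sum>i\<in>I. g i)"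
  using assms
proof (induction I rule: finite_induct)
  case empty
  then show ?case using val_ring[of "{}"] by simp
next
  case (insert j I)
  have "P j \<inter> (\<Union>i\<in>I. P i) = {}"
    using insert.prems(2) insert.hyps(2)
    unfolding disjoint_family_on_def Int_UN_distrib by auto
  moreover have dj: "disjoint_family_on P I"
    by (rule disjoint_family_on_mono[OF subset_insertI insert.prems(2)])
  ultimately have "val (P j \<union> (\<Union>i\<in>I. P i)) (g j + (\<Sum>i\<in>I. g i))"
    by (intro val_Un insert.IH insert.prems(1) dj) simp_all
  then show ?case using insert.hyps by simp
qed

text \<open>Transfers \<open>small_tail\<close> from ring sets to their limits. Each
  \<open>P n\<close> is replaced by a ring set \<open>F n\<close> up to an error of tolerance
  \<open>W n\<close>, and all errors together are still small. A tail of the \<open>P n\<close> lies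
  in the union of the errors and a tail of the \<open>F n\<close>.\<close>

lemma small_tail_val:
  assumes P: "\<And>n::nat. val (P n) (g n)" and U: "zero_nbhd U"
  shows "\<exists>N. small U ((\<Union>n. P n) - (\<Union>i<N. P i))"
proof -
  obtain V where V0: "quarter V U" using quarter_exists[OF U] .
  note V = quarterD[OF V0]
  obtain Z where Z0: "quarter Z V" using quarter_exists[OF V(1)] .
  note Z = quarterD[OF Z0]
  obtain W where W: "\<And>n::nat. zero_nbhd (W n)"
    "\<And>N x. (\<And>i. i < N \<Longrightarrow> x i \<in> W i) \<Longrightarrow> sum x {..<N} \<in> Z"
    using quarter_sequence[OF Z(1)] by blast
  have "\<exists>F\<in>R. small (W n) (sym_diff (P n) F)" for n
    using P[of n] W(1)[of n] unfolding val_def by blast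
  then obtain F where F: "\<And>n. F n \<in> R" "\<And>n. small (W n) (sym_diff (P n) (F n))"
    by metis
  have sm: "small V (\<Union>n. sym_diff (P n) (F n))"
  proof (rule small_UN[OF F(2) W(2) Z(1)])
    show "x - y \<in> V" if "x \<in> Z" "y \<in> Z" for x y
      using Z(5)[OF that(1) Z(3)[OF that(2)]] by simp
  qed
  obtain N where N: "small V ((\<Union>n. F n) - (\<Union>i<N. F i))"
    using small_tail[of F V] F(1) V(1) by blast
  have "small U ((\<Union>n. P n) - (\<Union>i<N. P i))"
    by (rule small_mono[OF small_Un[OF V0 sm N]]) blast+
  then show ?thesis ..
qed

text \<open>Sequential completeness enters here: small tails make the partial sums Cauchy, and their
  limit in the group is the value of the union.\<close>

lemma val_UN:
  assumes P: "\<And>n::nat. val (P n) (g n)" and dj: "disjoint_family P"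
  shows "\<exists>h. val (\<Union>n. P n) h"
proof -
  define s where "s N = (\<Sum>i<N. g i)" for N
  define Q where "Q N = (\<Union>i<N. P i)" for N
  have Q: "val (Q N) (s N)" for N
    unfolding Q_def s_def using P dj by (intro val_finite_UN) (auto simp: disjoint_family_on_def)
  have Q_mono: "Q i \<subseteq> Q j" if "i \<le> j" for i j
    unfolding Q_def using that by (intro UN_mono) auto
  have Q_sub: "Q i \<subseteq> (\<Union>n. P n)" for i
    unfolding Q_def by auto
  have "convergent s"
  proof (rule convergent_if_sequentially_complete[OF complete])
    fix U :: "'a set" assume "zero_nbhd U"
    then obtain V where V0: "quarter V U" using quarter_exists by blast
    note V = quarterD[OF V0]
    obtain W where W: "quarter W V" "\<And>E g. small W E \<Longrightarrow> val E g \<Longrightarrow> g \<in> V"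
      using val_small[OF V(1)] by blast
    obtain N where N: "small W ((\<Union>n. P n) - Q N)"
      using small_tail_val[of P g W] P quarterD(1)[OF W(1)] unfolding Q_def by blast
    have d: "s i - s N \<in> V" if "i \<ge> N" for i
    proof (rule W(2))
      show "val (Q i - Q N) (s i - s N)" using val_Diff[OF Q Q Q_mono] that by blast
      show "small W (Q i - Q N)" by (rule small_mono[OF N]) (use Q_sub in auto)
    qed
    have "s i - s j \<in> U" if "i \<ge> N" "j \<ge> N" for i j
      using V(5)[OF d[OF that(1)] V(3)[OF d[OF that(2)]]] by simp
    then show "\<exists>N. \<forall>i\<ge>N. \<forall>j\<ge>N. s i - s j \<in> U" by blast
  qed
  then obtain h where h: "s \<longlonglongrightarrow> h" unfolding convergent_def by blast
  have "val (\<Union>n. P n) h"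
    unfolding val_def
  proof safe
    fix U :: "'a set" assume "zero_nbhd U"
    then obtain W where W0: "quarter W U" using quarter_exists by blast
    note W = quarterD[OF W0]
    obtain N where N: "small W ((\<Union>n. P n) - Q N)"
      using small_tail_val[of P g W] P W(1) unfolding Q_def by blast
    obtain M where M: "\<And>n. n \<ge> M \<Longrightarrow> s n - h \<in> W"
      using h W(1) unfolding tendsto_zero_nbhd_iff eventually_sequentially by blast
    \<comment> \<open>Past \<open>N\<close> the missing part of the union is small, past
      \<open>M\<close> the partial sum is close to \<open>h\<close>; an approximant of
      \<open>Q ?K\<close> profits from both.\<close>
    let ?K = "max M N"
    obtain F where F: "F \<in> R" "small W (sym_diff (Q ?K) F)" "m F - s ?K \<in> W"
      using Q[of ?K] W(1) unfolding val_def by blast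
    have "small U (sym_diff (\<Union>n. P n) F)"
      by (rule small_mono[OF small_Un[OF W0 N F(2)]])
        (use Q_mono[of N ?K] Q_sub[of ?K] in auto)
    moreover have "m F - h \<in> U"
      using W(5)[OF F(3) M[of ?K]] by simp
    ultimately show "\<exists>F\<in>R. small U (sym_diff (\<Union>n. P n) F) \<and> m F - h \<in> U"
      using F(1) by blast
  qed
  then show ?thesis ..
qed

text \<open>The sets having a value form a Dynkin system containing the intersection-stable
  \<open>R\<close>. Disjointness in \<open>val_UN\<close> is what calls for Dynkin induction instead
  of plain induction over the generated sigma-algebra.\<close>

lemma val_exists:
  assumes "E \<in> sigma_sets A R"
  shows "\<exists>g. val E g"
proof -
  \<comment> \<open>Complements need a value of \<open>A\<close>, which may lie outside
    \<open>R\<close>; a disjointed exhaustion by ring sets supplies it.\<close>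
  have A: "\<exists>g. val A g"
  proof -
    obtain C :: "nat \<Rightarrow> 'b set" where C: "range C \<subseteq> R" "(\<Union>n. C n) = A"
      using sigma_finite by (elim exE conjE) (rule that)
    have "val (disjointed C n) (m (disjointed C n))" for n
      using range_disjointed_sets[OF C(1)] by (intro val_ring) auto
    from val_UN[OF this disjoint_family_disjointed] show ?thesis
      by (simp add: UN_disjointed_eq C(2))
  qed
  have "Int_stable R" unfolding Int_stable_def by auto
  then show ?thesis using space_closed assms
  proof (induction rule: sigma_sets_induct_disjoint)
    case (basic E) then show ?case using val_ring by blast
  next
    case empty then show ?case using val_ring[of "{}"] by auto
  next
    case (compl E)
    then show ?case using A val_Diff sigma_sets_into_sp[OF space_closed] by blast
  next
    case (union P)
    then have "\<forall>n. \<exists>g. val (P n) g" by (intro allI)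
    then obtain g where "\<forall>n. val (P n) (g n)" unfolding choice_iff ..
    then have "val (P n) (g n)" for n ..
    from val_UN[OF this union.hyps(1)] show ?case .
  qed
qed

text \<open>Unconditional summability comes from the tails: as soon as a finite \<open>J\<close>
  contains all indices of \<open>I\<close> below \<open>N\<close>, the rest of the union lies in one
  fixed small tail, so its value is small.\<close>

theorem extension:
  obtains n where "\<And>E. E \<in> R \<Longrightarrow> n E = m E"
    "\<And>(I :: nat set) P. P ` I \<subseteq> sigma_sets A R \<Longrightarrow> disjoint_family_on P I \<Longrightarrow>
       ((\<lambda>i. n (P i)) has_sum n (\<Union>i\<in>I. P i)) I"
proof -
  have "\<forall>E\<in>sigma_sets A R. \<exists>g. val E g" using val_exists by (rule ballI)
  then obtain n where "\<forall>E\<in>sigma_sets A R. val E (n E)" by (rule bchoice[THEN exE])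
  then have n: "val E (n E)" if "E \<in> sigma_sets A R" for E
    using that by (rule bspec)
  show ?thesis
  proof (rule that[of n])
    show "n E = m E" if "E \<in> R" for E
      using val_unique[OF n[OF sigma_sets.Basic[OF that]] val_ring[OF that]] .
    fix I :: "nat set" and P :: "nat \<Rightarrow> 'b set"
    assume P: "P ` I \<subseteq> sigma_sets A R" "disjoint_family_on P I"
    let ?E = "\<Union>i\<in>I. P i"
    have E: "?E \<in> sigma_sets A R"
      using P(1)
      by (intro sigma_algebra.countable_UN''[OF sigma_algebra_sigma_sets[OF space_closed]])
        (simp_all add: image_subset_iff)
    show "((\<lambda>i. n (P i)) has_sum n ?E) I"
      unfolding has_sum_def tendsto_zero_nbhd_iff
    proof safe
      fix U :: "'a set" assume "zero_nbhd U"
      then obtain V where V0: "quarter V U" using quarter_exists by blast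
      note V = quarterD[OF V0]
      obtain W where W: "quarter W V" "\<And>E g. small W E \<Longrightarrow> val E g \<Longrightarrow> g \<in> V"
        using val_small[OF V(1)] by blast
      \<comment> \<open>Indices outside \<open>I\<close> receive the empty set, so that the tail
        lemma for full sequences applies.\<close>
      define Q where "Q i = (if i \<in> I then P i else {})" for i
      have vQ: "val (Q i) (n (Q i))" for i
        using P(1) by (intro n) (simp add: Q_def image_subset_iff sigma_sets.Empty)
      obtain N where N: "small W ((\<Union>i. Q i) - (\<Union>i<N. Q i))"
        using small_tail_val[of Q "\<lambda>i. n (Q i)", OF vQ quarterD(1)[OF W(1)]] ..
      have Q: "(\<Union>i. Q i) = ?E"
        unfolding Q_def by (auto split: if_splits)
      have "sum (\<lambda>i. n (P i)) J - n ?E \<in> U" if J: "finite J" "I \<inter> {..<N} \<subseteq> J" "J \<subseteq> I" for J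
      proof -
        have "val (\<Union>i\<in>J. P i) (\<Sum>i\<in>J. n (P i))"
          using P(1) J by (intro val_finite_UN n disjoint_family_on_mono[OF J(3) P(2)]) auto
        then have v: "val (?E - (\<Union>i\<in>J. P i)) (n ?E - (\<Sum>i\<in>J. n (P i)))"
          using J(3) by (intro val_Diff n E) auto
        have "small W (?E - (\<Union>i\<in>J. P i))"
        proof (rule small_mono[OF N _ order_refl])
          have "(\<Union>i<N. Q i) \<subseteq> (\<Union>i\<in>J. P i)"
            using J(2) unfolding Q_def by (auto split: if_splits)
          then show "?E - (\<Union>i\<in>J. P i) \<subseteq> (\<Union>i. Q i) - (\<Union>i<N. Q i)"
            unfolding Q by (rule Diff_mono[OF order_refl])
        qed
        from W(2)[OF this v] have "- (n ?E - (\<Sum>i\<in>J. n (P i))) \<in> V"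
          by (rule V(3))
        then show ?thesis using V(4) by auto
      qed
      then show "\<forall>\<^sub>F J in finite_subsets_at_top I. sum (\<lambda>i. n (P i)) J - n ?E \<in> U"
        unfolding eventually_finite_subsets_at_top
        by (intro exI[of _ "I \<inter> {..<N}"]) auto
    qed
  qed
qed

end

subsection \<open>Rings, ideals and host rings\<close>

text \<open>The default classical rules turn \<open>E \<in> dom \<mu>\<close> into \<open>\<mu> E \<noteq> None\<close>, which
  hides the membership facts about rings and ideals.\<close>

declare domIff [iff del] domD [rule del]

lemma sigma_ringD:
  assumes "sigma_ring H"
  shows "{} \<in> H" "A \<in> H \<Longrightarrow> B \<in> H \<Longrightarrow> A \<union> B \<in> H" "A \<in> H \<Longrightarrow> B \<in> H \<Longrightarrow> A - B \<in> H"
    "A \<in> H \<Longrightarrow> B \<in> H \<Longrightarrow> A \<inter> B \<in> H"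
    "\<C> \<subseteq> H \<Longrightarrow> countable \<C> \<Longrightarrow> \<Union>\<C> \<in> H"
proof -
  show D: "A \<in> H \<Longrightarrow> B \<in> H \<Longrightarrow> A - B \<in> H" for A B
    using assms by (simp add: sigma_ring_def ring_of_sets_iff)
  show "A \<in> H \<Longrightarrow> B \<in> H \<Longrightarrow> A \<inter> B \<in> H"
    using D[of A "A - B"] D[of A B] by (simp add: Diff_Diff_Int)
qed (use assms in \<open>simp_all add: sigma_ring_def ring_of_sets_iff\<close>)

lemma sigma_ring_UN:
  fixes P :: "nat \<Rightarrow> 'b set"
  assumes "sigma_ring H" "\<And>i. i \<in> I \<Longrightarrow> P i \<in> H"
  shows "(\<Union>i\<in>I. P i) \<in> H"
  using assms(2) by (intro sigma_ringD(5)[OF assms(1)]) auto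

lemma sigma_ring_Inter:
  assumes "sigma_ring H" "\<C> \<subseteq> H" "countable \<C>" "A \<in> \<C>"
  shows "\<Inter>\<C> \<in> H"
proof -
  have "\<Inter>\<C> = A - \<Union>((-) A ` \<C>)"
    using assms(4) by auto
  moreover have "\<Union>((-) A ` \<C>) \<in> H"
    using assms by (intro sigma_ringD(5)) (auto intro: sigma_ringD(3)[OF assms(1)])
  ultimately show ?thesis
    using sigma_ringD(3)[OF assms(1), of A "\<Union>((-) A ` \<C>)"] assms(2,4) by (metis subsetD)
qed

lemma sigma_ringI:
  assumes "{} \<in> H" "\<And>A B. A \<in> H \<Longrightarrow> B \<in> H \<Longrightarrow> A - B \<in> H"
    and UN: "\<And>P :: nat \<Rightarrow> 'b set. range P \<subseteq> H \<Longrightarrow> (\<Union>n. P n) \<in> H"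
  shows "sigma_ring H"
proof -
  have U: "\<Union>\<C> \<in> H" if "\<C> \<subseteq> H" "countable \<C>" for \<C>
  proof (cases "\<C> = {}")
    case False
    then have "range (from_nat_into \<C>) = \<C>"
      using that(2) by (rule range_from_nat_into)
    then show ?thesis using UN[of "from_nat_into \<C>"] that(1) by simp
  qed (use assms(1) in simp)
  moreover have "A \<union> B \<in> H" if "A \<in> H" "B \<in> H" for A B
    using U[of "{A, B}"] that by simp
  ultimately show ?thesis
    using assms by (simp add: sigma_ring_def ring_of_sets_iff)
qed

lemma sigma_ring_hull: "sigma_ring (sigma_ring hull K)"
proof (rule sigma_ringI)
  show "{} \<in> sigma_ring hull K"
    unfolding hull_def by (auto dest: sigma_ringD(1))
  show "A - B \<in> sigma_ring hull K" if "A \<in> sigma_ring hull K" "B \<in> sigma_ring hull K" for A B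
    using that unfolding hull_def by (auto dest: sigma_ringD(3))
  show "(\<Union>n. P n) \<in> sigma_ring hull K" if "range P \<subseteq> sigma_ring hull K" for P :: "nat \<Rightarrow> 'a set"
    unfolding hull_def
  proof safe
    fix T assume T: "sigma_ring T" "K \<subseteq> T"
    then have "sigma_ring hull K \<subseteq> T" by (simp add: hull_minimal)
    then show "(\<Union>n. P n) \<in> T" using that by (intro sigma_ring_UN[OF T(1)]) blast
  qed
qed

lemma sigma_ring_host: "sigma_ring (host \<mu>)"
  unfolding host_def by (rule sigma_ring_hull)

lemma dom_subset_host: "dom \<mu> \<subseteq> host \<mu>"
  unfolding host_def by (rule hull_subset)

lemma host_eqI:
  assumes "dom \<mu> \<subseteq> dom \<nu>" "dom \<nu> \<subseteq> host \<mu>"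
  shows "host \<nu> = host \<mu>"
  using assms hull_mono[OF assms(1), of sigma_ring] hull_mono[OF assms(2), of sigma_ring]
  unfolding host_def by (simp add: antisym)

section \<open>Countable unions and countable coverings\<close>

lemma countable_unionsE:
  assumes "A \<in> countable_unions K" "{} \<in> K"
  obtains C :: "nat \<Rightarrow> 'b set" where "range C \<subseteq> K" "(\<Union>n. C n) = A"
proof -
  obtain \<C> where \<C>: "\<C> \<subseteq> K" "countable \<C>" "A = \<Union>\<C>"
    using assms(1) unfolding countable_unions_def by blast
  \<comment> \<open>Enumerating requires a nonempty family; adjoining the empty set leaves the union
    unchanged.\<close>
  have r: "range (from_nat_into (insert {} \<C>)) = insert {} \<C>"
    using \<C>(2) by (intro range_from_nat_into) auto
  show ?thesis
    by (rule that[of "from_nat_into (insert {} \<C>)"]) (use r \<C> assms(2) in auto)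
qed

text \<open>The sets with a countable cover from \<open>K\<close> form a sigma-ring containing
  \<open>K\<close>.\<close>

lemma hull_covered:
  assumes "{} \<in> K" "B \<in> sigma_ring hull K"
  obtains C :: "nat \<Rightarrow> 'b set" where "range C \<subseteq> K" "B \<subseteq> (\<Union>n. C n)"
proof -
  let ?cov = "\<lambda>B. \<exists>C. countable C \<and> C \<subseteq> K \<and> B \<subseteq> \<Union>C"
  have "sigma_ring {B. ?cov B}"
  proof (rule sigma_ringI)
    show "{} \<in> {B. ?cov B}" by auto
    show "A - B \<in> {B. ?cov B}" if "A \<in> {B. ?cov B}" for A B
      using that by blast
    show "(\<Union>n. P n) \<in> {B. ?cov B}" if "range P \<subseteq> {B. ?cov B}" for P :: "nat \<Rightarrow> 'b set"
    proof -
      have "\<forall>n. ?cov (P n)" using that unfolding image_subset_iff by simp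
      then obtain C where C: "\<forall>n. countable (C n) \<and> C n \<subseteq> K \<and> P n \<subseteq> \<Union>(C n)"
        unfolding choice_iff ..
      show ?thesis
      proof (intro CollectI exI conjI)
        show "countable (\<Union>n. C n)" "(\<Union>n. C n) \<subseteq> K" using C by auto
        have "(\<Union>n. P n) \<subseteq> (\<Union>n. \<Union>(C n))" using C by (intro UN_mono) simp_all
        also have "\<dots> = \<Union>(\<Union>n. C n)" by (rule UN_UN_flatten[of id, simplified, symmetric])
        finally show "(\<Union>n. P n) \<subseteq> \<Union>(\<Union>n. C n)" .
      qed
    qed
  qed
  moreover have "?cov B" if "B \<in> K" for B
    using that by (intro exI[of _ "{B}"]) auto
  ultimately have "?cov B"
    using assms(2) by (rule_tac hull_induct[of B sigma_ring K])
  then obtain D where "D \<in> countable_unions K" "B \<subseteq> D"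
    unfolding countable_unions_def by blast
  then show ?thesis
    using assms(1) that by (elim countable_unionsE) simp_all
qed

text \<open>Order ideals stand in for delta-rings. \<open>H\<close> is a parameter because the
  domains to be glued, such as all host sets below a fixed \<open>A\<close>, may generate a
  sigma-ring smaller than the host.\<close>

definition ideal_in :: "'b set set \<Rightarrow> 'b set set \<Rightarrow> bool" where
  "ideal_in H D \<longleftrightarrow> D \<subseteq> H \<and> {} \<in> D \<and> (\<forall>A\<in>D. \<forall>B\<in>D. A \<union> B \<in> D) \<and>
     (\<forall>A\<in>D. \<forall>B\<in>H. B \<subseteq> A \<longrightarrow> B \<in> D)"

lemma ideal_inD:
  assumes "ideal_in H D"
  shows "D \<subseteq> H" "{} \<in> D" "A \<in> D \<Longrightarrow> B \<in> D \<Longrightarrow> A \<union> B \<in> D"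
    "A \<in> D \<Longrightarrow> B \<in> H \<Longrightarrow> B \<subseteq> A \<Longrightarrow> B \<in> D"
  using assms unfolding ideal_in_def by simp_all

lemma ideal_in_Int:
  assumes "ideal_in H D" "sigma_ring H" "A \<in> D" "B \<in> H"
  shows "A \<inter> B \<in> D" "B \<inter> A \<in> D" "A - B \<in> D"
proof -
  have A: "A \<in> H" using ideal_inD(1)[OF assms(1)] assms(3) by blast
  show Int: "A \<inter> B \<in> D"
    using sigma_ringD(4)[OF assms(2) A assms(4)] by (rule ideal_inD(4)[OF assms(1,3)]) blast
  then show "B \<inter> A \<in> D" by (simp only: Int_commute)
  show "A - B \<in> D"
    using sigma_ringD(3)[OF assms(2) A assms(4)] by (rule ideal_inD(4)[OF assms(1,3)]) blast
qed

text \<open>The sets whose trace on every member of \<open>D\<close> is in \<open>D\<close> form a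
  sigma-ring: inside \<open>A\<close>, a countable union is the complement of a countable
  intersection, which a delta-ring admits.\<close>

lemma delta_ring_ideal:
  assumes "delta_ring D"
  shows "ideal_in (sigma_ring hull D) D"
proof -
  have ring: "{} \<in> D" "\<And>A B. A \<in> D \<Longrightarrow> B \<in> D \<Longrightarrow> A \<union> B \<in> D" "\<And>A B. A \<in> D \<Longrightarrow> B \<in> D \<Longrightarrow> A - B \<in> D"
    and Inter: "\<And>\<C>. \<C> \<subseteq> D \<Longrightarrow> countable \<C> \<Longrightarrow> \<C> \<noteq> {} \<Longrightarrow> \<Inter>\<C> \<in> D"
    using assms by (auto simp: delta_ring_def ring_of_sets_iff)
  let ?T = "{B. \<forall>A\<in>D. A \<inter> B \<in> D}"
  have "sigma_ring ?T"
  proof (rule sigma_ringI)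
    show "A - B \<in> ?T" if "A \<in> ?T" "B \<in> ?T" for A B
      using that ring(3) by (auto simp: Diff_Int_distrib)
    show "(\<Union>n. P n) \<in> ?T" if P: "range P \<subseteq> ?T" for P :: "nat \<Rightarrow> 'a set"
    proof safe
      fix A assume A: "A \<in> D"
      have "A \<inter> (\<Union>n. P n) = A - \<Inter>(range (\<lambda>n. A - A \<inter> P n))" by auto
      moreover have "\<Inter>(range (\<lambda>n. A - A \<inter> P n)) \<in> D"
        using P A by (intro Inter) (auto intro!: ring(3))
      ultimately show "A \<inter> (\<Union>n. P n) \<in> D"
        using ring(3)[OF A] by metis
    qed
  qed (use ring in auto)
  moreover have "A \<inter> B \<in> D" if "A \<in> D" "B \<in> D" for A B
    using ring(3)[OF that(1) ring(3)[OF that]] by (simp add: Diff_Diff_Int)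
  ultimately have "sigma_ring hull D \<subseteq> ?T"
    by (intro hull_minimal) auto
  then show ?thesis
    unfolding ideal_in_def using ring hull_subset[of D sigma_ring]
    by (auto simp: Int_absorb1 subset_iff) (metis Int_absorb1 subset_iff)
qed

lemma ideal_delta_ring:
  assumes "sigma_ring H" "ideal_in H D"
  shows "delta_ring D"
proof -
  note D = ideal_inD[OF assms(2)]
  have "\<Inter>\<C> \<in> D" if \<C>: "\<C> \<subseteq> D" "countable \<C>" "A \<in> \<C>" for \<C> A
  proof (rule D(4))
    show "A \<in> D" "\<Inter>\<C> \<subseteq> A" using \<C> by auto
    show "\<Inter>\<C> \<in> H" using \<C> D(1) by (intro sigma_ring_Inter[OF assms(1)]) auto
  qed
  then show ?thesis
    unfolding delta_ring_def ring_of_sets_iff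
    using D ideal_in_Int(3)[OF assms(2,1)] by auto
qed

lemma premeasure_ideal: "premeasure \<mu> \<Longrightarrow> ideal_in (host \<mu>) (dom \<mu>)"
  unfolding premeasure_def host_def using delta_ring_ideal by blast

lemma ideal_premeasure: "sigma_ring H \<Longrightarrow> ideal_in H (dom \<mu>) \<Longrightarrow> sigma_additive \<mu> \<Longrightarrow> premeasure \<mu>"
  unfolding premeasure_def using ideal_delta_ring by blast

subsection \<open>Gluing \<open>\<sigma>\<close>-additive maps\<close>

lemma sigma_additiveD:
  fixes P :: "nat \<Rightarrow> 'b set"
  assumes "sigma_additive \<mu>" "\<And>i. i \<in> I \<Longrightarrow> P i \<in> dom \<mu>" "disjoint_family_on P I"
    "(\<Union>i\<in>I. P i) \<in> dom \<mu>"
  shows "((\<lambda>i. the (\<mu> (P i))) has_sum the (\<mu> (\<Union>i\<in>I. P i))) I"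
proof -
  have "P ` I \<subseteq> dom \<mu>" using assms(2) by blast
  with assms show ?thesis unfolding sigma_additive_def by blast
qed

lemma sigma_additive_empty:
  assumes "sigma_additive \<mu>" "{} \<in> dom \<mu>"
  shows "the (\<mu> {}) = 0"
  using sigma_additiveD[OF assms(1), of "{}" "\<lambda>_. {}"] assms(2) has_sum_unique has_sum_empty
  by (fastforce simp: disjoint_family_on_def)

lemma sigma_additive_Un:
  assumes "sigma_additive \<mu>" "A \<in> dom \<mu>" "B \<in> dom \<mu>" "A \<union> B \<in> dom \<mu>" "A \<inter> B = {}"
  shows "the (\<mu> (A \<union> B)) = the (\<mu> A) + the (\<mu> B)"
proof -
  let ?P = "\<lambda>i::nat. if i = 0 then A else B"
  have U: "(\<Union>i\<in>{0,1}. ?P i) = A \<union> B" by auto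
  have "((\<lambda>i. the (\<mu> (?P i))) has_sum the (\<mu> (\<Union>i\<in>{0,1}. ?P i))) {0,1}"
  proof (rule sigma_additiveD[OF assms(1)])
    show "(\<Union>i\<in>{0,1}. ?P i) \<in> dom \<mu>" unfolding U by (rule assms)
  qed (use assms in \<open>auto simp: disjoint_family_on_def\<close>)
  moreover have "((\<lambda>i. the (\<mu> (?P i))) has_sum (\<Sum>i\<in>{0,1}. the (\<mu> (?P i)))) {0,1}"
    by (rule has_sum_finite) simp
  ultimately have "the (\<mu> (A \<union> B)) = (\<Sum>i\<in>{0,1}. the (\<mu> (?P i)))"
    unfolding U by (rule has_sum_unique)
  then show ?thesis by simp
qed

lemma sigma_additive_split:
  assumes "sigma_additive \<mu>" "ideal_in H (dom \<mu>)" "sigma_ring H" "A \<in> dom \<mu>" "B \<in> H"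
  shows "the (\<mu> A) = the (\<mu> (A \<inter> B)) + the (\<mu> (A - B))"
  using sigma_additive_Un[OF assms(1) ideal_in_Int(1)[OF assms(2-5)] ideal_in_Int(3)[OF assms(2-5)]] assms(4)
  by (simp add: Int_Diff_Un Int_Diff_disjoint)

section \<open>Traces on a set and agreement of additive maps\<close>

lemma ring_of_sets_UNIV_Int:
  assumes "ring_of_sets UNIV R" "A \<in> R" "B \<in> R"
  shows "A \<inter> B \<in> R"
proof -
  have "A - (A - B) \<in> R" using assms unfolding ring_of_sets_iff by (simp del: Diff_Diff_Int)
  then show ?thesis by (simp only: Diff_Diff_Int)
qed

lemma trace_ring:
  assumes "ring_of_sets UNIV R"
  shows "ring_of_sets A (R \<inter> Pow A)"
proof -
  from assms have "{} \<in> R" "\<And>E F. E \<in> R \<Longrightarrow> F \<in> R \<Longrightarrow> E \<union> F \<in> R"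
    "\<And>E F. E \<in> R \<Longrightarrow> F \<in> R \<Longrightarrow> E - F \<in> R"
    unfolding ring_of_sets_iff by simp_all
  then show ?thesis
    unfolding ring_of_sets_iff by (intro conjI ballI) auto
qed

text \<open>Bridge between the host sigma-ring, which may have no largest set, and the sigma-algebra
  on \<open>A\<close> that carries the extension and the Dynkin inductions.\<close>

lemma hull_trace:
  fixes C :: "nat \<Rightarrow> 'b set"
  assumes R: "ring_of_sets UNIV R" and C: "range C \<subseteq> R" "(\<Union>n. C n) = A"
  shows "sigma_sets A (R \<inter> Pow A) = {B \<in> sigma_ring hull R. B \<subseteq> A}"
proof safe
  let ?S = "sigma_sets A (R \<inter> Pow A)" and ?H = "sigma_ring hull R"
  note H = sigma_ringD[OF sigma_ring_hull[of R]]
  have A: "A \<in> ?H"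
    unfolding C(2)[symmetric] using C(1) hull_subset[of R sigma_ring]
    by (intro sigma_ring_UN sigma_ring_hull) blast
  show "B \<in> ?H" if "B \<in> ?S" for B
    using that
  proof induction
    case (Union P)
    then show ?case by (intro sigma_ring_UN sigma_ring_hull)
  qed (use A H in \<open>auto intro: hull_inc\<close>)
  show "x \<in> A" if "B \<in> ?S" "x \<in> B" for B x
    using sigma_sets_into_sp[OF _ that(1)] that(2) by auto
  interpret S: sigma_algebra A ?S
    by (rule sigma_algebra_sigma_sets) auto
  have R': "E \<inter> F \<in> R" if "E \<in> R" "F \<in> R" for E F
    by (rule ring_of_sets_UNIV_Int[OF R that])
  \<comment> \<open>A ring set \<open>E\<close> belongs to \<open>?T\<close> because its trace on
    \<open>A\<close> is the union of the ring sets \<open>E \<inter> C n\<close>.\<close>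
  let ?T = "{B. B \<inter> A \<in> ?S}"
  have "sigma_ring ?T"
  proof (rule sigma_ringI)
    show "E - F \<in> ?T" if "E \<in> ?T" "F \<in> ?T" for E F
      using that S.Diff[of "E \<inter> A" "F \<inter> A"] by (simp add: Diff_Int_distrib2)
    show "(\<Union>n. P n) \<in> ?T" if "range P \<subseteq> ?T" for P :: "nat \<Rightarrow> 'b set"
    proof -
      have "(\<Union>n. P n \<inter> A) \<in> ?S"
        using that by (intro sigma_sets.Union) blast
      then show ?thesis by simp
    qed
  qed (auto intro: sigma_sets.Empty)
  moreover have "R \<subseteq> ?T"
  proof safe
    fix E assume E: "E \<in> R"
    have "(\<Union>n. E \<inter> C n) \<in> ?S"
    proof (rule sigma_sets.Union)
      fix n
      have "E \<inter> C n \<in> R" "E \<inter> C n \<subseteq> A"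
        using R'[OF E] C by auto
      then show "E \<inter> C n \<in> ?S" by (intro sigma_sets.Basic) simp
    qed
    then show "E \<inter> A \<in> ?S" by (simp add: C(2)[symmetric])
  qed
  ultimately have "?H \<subseteq> ?T" by (rule hull_minimal[rotated])
  then show "B \<in> ?S" if "B \<in> ?H" "B \<subseteq> A" for B
    using that by (auto simp: Int_absorb2)
qed

text \<open>Below a ring set common to both domains, equality follows by Dynkin induction. A set
  covered by countably many such ring sets is cut along the disjointed cover, and countable
  additivity recombines the pieces.\<close>

lemma sigma_additive_agree:
  fixes C :: "nat \<Rightarrow> 'b set"
  assumes R: "ring_of_sets UNIV R"
    and \<mu>: "sigma_additive \<mu>" "ideal_in (sigma_ring hull R) (dom \<mu>)"
    and \<nu>: "sigma_additive \<nu>" "ideal_in (sigma_ring hull R) (dom \<nu>)"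
    and eq: "\<And>E. E \<in> R \<Longrightarrow> E \<in> dom \<mu> \<Longrightarrow> E \<in> dom \<nu> \<Longrightarrow> \<mu> E = \<nu> E"
    and C: "range C \<subseteq> R" "range C \<subseteq> dom \<mu>" "range C \<subseteq> dom \<nu>"
    and B: "B \<in> dom \<mu>" "B \<in> dom \<nu>" "B \<subseteq> (\<Union>n. C n)"
  shows "\<mu> B = \<nu> B"
proof -
  let ?H = "sigma_ring hull R"
  note H = sigma_ring_hull[of R]
  have local: "the (\<mu> E) = the (\<nu> E)"
    if A: "A \<in> R" "A \<in> dom \<mu>" "A \<in> dom \<nu>" and E: "E \<in> ?H" "E \<subseteq> A" for A E
  proof -
    let ?G = "R \<inter> Pow A"
    have trace: "sigma_sets A ?G = {B \<in> ?H. B \<subseteq> A}"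
      using A(1) by (intro hull_trace[OF R, of "\<lambda>_. A"]) auto
    have in_dom: "F \<in> dom \<mu>" "F \<in> dom \<nu>" if "F \<in> sigma_sets A ?G" for F
      using that A ideal_inD(4)[OF \<mu>(2)] ideal_inD(4)[OF \<nu>(2)] unfolding trace by blast+
    have "Int_stable ?G"
      using ring_of_sets.axioms(1)[OF trace_ring[OF R, of A]]
      unfolding Int_stable_def semiring_of_sets_def semiring_of_sets_axioms_def by blast
    moreover have "?G \<subseteq> Pow A" by blast
    moreover have "E \<in> sigma_sets A ?G" using E trace by blast
    ultimately show ?thesis
    proof (induction rule: sigma_sets_induct_disjoint)
      case (basic F)
      then have "F \<in> sigma_sets A ?G" by (rule sigma_sets.Basic)
      with basic show ?case using eq in_dom by auto
    next
      case empty
      then show ?case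
        using sigma_additive_empty \<mu> \<nu> ideal_inD(2) by metis
    next
      case (compl F)
      then have F: "F \<in> ?H" "A \<inter> F = F" unfolding trace by auto
      have "the (\<mu> A) = the (\<nu> A)" using eq A by simp
      then show ?case
        using sigma_additive_split[OF \<mu> H A(2) F(1)] sigma_additive_split[OF \<nu> H A(3) F(1)] compl
        by (simp add: F(2))
    next
      case (union P)
      have P: "P i \<in> sigma_sets A ?G" "(\<Union>i. P i) \<in> sigma_sets A ?G" for i
        using union.hyps(2) by (auto intro: sigma_sets.Union)
      have "((\<lambda>i. the (\<mu> (P i))) has_sum the (\<mu> (\<Union>i. P i))) UNIV"
        "((\<lambda>i. the (\<nu> (P i))) has_sum the (\<nu> (\<Union>i. P i))) UNIV"
        by (intro sigma_additiveD \<mu>(1) \<nu>(1) in_dom P union.hyps)+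
      then show ?case
        unfolding union.IH by (rule has_sum_unique)
    qed
  qed
  let ?Q = "\<lambda>n. B \<inter> disjointed C n"
  have BH: "B \<in> ?H" using B(1) ideal_inD(1)[OF \<mu>(2)] by blast
  have D: "disjointed C n \<in> R" for n
    using ring_of_sets.range_disjointed_sets[OF R C(1)] by blast
  then have DH: "disjointed C n \<in> ?H" for n by (rule hull_inc)
  have QH: "?Q n \<in> ?H" for n
    using sigma_ringD(4)[OF H BH DH] .
  have Q: "?Q n \<in> dom \<mu>" "?Q n \<in> dom \<nu>" for n
    using B QH ideal_inD(4)[OF \<mu>(2)] ideal_inD(4)[OF \<nu>(2)] by blast+
  have U: "(\<Union>n. ?Q n) = B"
    using B(3) UN_disjointed_eq[of C] by auto
  have dj: "disjoint_family ?Q"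
    using disjoint_family_disjointed[of C] unfolding disjoint_family_on_def by blast
  have "the (\<mu> (?Q n)) = the (\<nu> (?Q n))" for n
  proof (rule local[of "disjointed C n"])
    have "C n \<in> dom \<mu>" "C n \<in> dom \<nu>" using C(2,3) by blast+
    then show "disjointed C n \<in> dom \<mu>" "disjointed C n \<in> dom \<nu>"
      using ideal_inD(4)[OF \<mu>(2) _ DH disjointed_subset] ideal_inD(4)[OF \<nu>(2) _ DH disjointed_subset]
      by simp_all
  qed (use D QH in simp_all)
  moreover have "((\<lambda>n. the (\<mu> (?Q n))) has_sum the (\<mu> B)) UNIV"
    using sigma_additiveD[OF \<mu>(1) Q(1) dj, unfolded U, OF B(1)] .
  moreover have "((\<lambda>n. the (\<nu> (?Q n))) has_sum the (\<nu> B)) UNIV"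
    using sigma_additiveD[OF \<nu>(1) Q(2) dj, unfolded U, OF B(2)] .
  ultimately have "the (\<mu> B) = the (\<nu> B)"
    by (simp add: has_sum_unique)
  then show ?thesis using domD[OF B(1)] domD[OF B(2)] by auto
qed

text \<open>A set of the joint domain splits into a part from each domain and receives the sum of
  the two values. Two splittings differ by \<open>A - B\<close> and \<open>B - A\<close>, which
  belong to both domains, where the maps agree.\<close>

lemma sigma_additive_join:
  fixes \<mu> \<nu> :: "'b set \<rightharpoonup> 'a::{topological_ab_group_add, t2_space}"
  assumes H: "sigma_ring H"
    and \<mu>: "sigma_additive \<mu>" "ideal_in H (dom \<mu>)"
    and \<nu>: "sigma_additive \<nu>" "ideal_in H (dom \<nu>)"
    and eq: "\<And>E. E \<in> dom \<mu> \<Longrightarrow> E \<in> dom \<nu> \<Longrightarrow> \<mu> E = \<nu> E"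
  obtains \<rho> where "sigma_additive \<rho>" "ideal_in H (dom \<rho>)" "\<mu> \<subseteq>\<^sub>m \<rho>" "\<nu> \<subseteq>\<^sub>m \<rho>"
proof -
  note M = ideal_inD[OF \<mu>(2)] and N = ideal_inD[OF \<nu>(2)]
  define dec where "dec E A \<longleftrightarrow> A \<in> dom \<mu> \<and> A \<subseteq> E \<and> E - A \<in> dom \<nu>" for E A
  define \<rho> where "\<rho> E = (if \<exists>A. dec E A then
    Some (the (\<mu> (SOME A. dec E A)) + the (\<nu> (E - (SOME A. dec E A)))) else None)" for E
  have dom: "E \<in> dom \<rho> \<longleftrightarrow> (\<exists>A. dec E A)" for E
    by (simp add: \<rho>_def dom_def)
  have wd: "the (\<mu> A) + the (\<nu> (E - A)) = the (\<mu> B) + the (\<nu> (E - B))" if A: "dec E A" and B: "dec E B" for E A B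
  proof -
    have AH: "A \<in> H" "B \<in> H" "A \<in> dom \<mu>" "B \<in> dom \<mu>" "E - A \<in> dom \<nu>" "E - B \<in> dom \<nu>" "A \<subseteq> E" "B \<subseteq> E"
      using A B M(1) unfolding dec_def by auto
    have set: "(E - A) \<inter> B = B - A" "(E - B) \<inter> A = A - B" "E - B - A = E - A - B"
      using AH(7,8) by auto
    have "the (\<nu> (E - A)) = the (\<nu> (B - A)) + the (\<nu> (E - A - B))"
      "the (\<nu> (E - B)) = the (\<nu> (A - B)) + the (\<nu> (E - A - B))"
      using sigma_additive_split[OF \<nu> H AH(5,2)] sigma_additive_split[OF \<nu> H AH(6,1)]
      unfolding set by simp_all
    moreover have "\<mu> (B - A) = \<nu> (B - A)" "\<mu> (A - B) = \<nu> (A - B)"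
    proof -
      have "B - A \<in> dom \<nu>" "A - B \<in> dom \<nu>"
        using N(4)[OF AH(5) sigma_ringD(3)[OF H AH(2,1)]] N(4)[OF AH(6) sigma_ringD(3)[OF H AH(1,2)]] AH(7,8)
        by blast+
      then show "\<mu> (B - A) = \<nu> (B - A)" "\<mu> (A - B) = \<nu> (A - B)"
        using eq ideal_in_Int(3)[OF \<mu>(2) H AH(3,2)] ideal_in_Int(3)[OF \<mu>(2) H AH(4,1)] by simp_all
    qed
    moreover have "the (\<mu> A) = the (\<mu> (A \<inter> B)) + the (\<mu> (A - B))"
      "the (\<mu> B) = the (\<mu> (A \<inter> B)) + the (\<mu> (B - A))"
      using sigma_additive_split[OF \<mu> H AH(3,2)] sigma_additive_split[OF \<mu> H AH(4,1)]
      by (simp_all add: Int_commute)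
    ultimately show ?thesis by (simp add: add_ac)
  qed
  have val: "\<rho> E = Some (the (\<mu> A) + the (\<nu> (E - A)))" if "dec E A" for E A
  proof -
    have "dec E (SOME A. dec E A)" using that by (rule someI)
    from wd[OF this that] that show ?thesis by (auto simp: \<rho>_def)
  qed
  have decD: "A \<in> dom \<mu>" "A \<in> H" "A \<subseteq> E" "E - A \<in> dom \<nu>" "E - A \<in> H" "E \<in> H" if "dec E A" for E A
  proof -
    show A: "A \<in> dom \<mu>" "A \<subseteq> E" "E - A \<in> dom \<nu>" using that unfolding dec_def by auto
    then show H': "A \<in> H" "E - A \<in> H" using M(1) N(1) by auto
    show "E \<in> H" using sigma_ringD(2)[OF H H'] A(2) by (simp add: Un_absorb1)
  qed
  \<comment> \<open>One splitting of \<open>E\<close> cuts all its subsets in \<open>H\<close>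
    consistently; this gives the ideal property and prepares additivity.\<close>
  have dec_sub: "dec B (B \<inter> A)" if E: "dec E A" and B: "B \<in> H" "B \<subseteq> E" for A B E
    unfolding dec_def
  proof (intro conjI)
    show "B \<inter> A \<in> dom \<mu>" by (rule ideal_in_Int(2)[OF \<mu>(2) H decD(1)[OF E] B(1)])
    have "B - A \<in> dom \<nu>"
      using B(2) by (intro N(4)[OF decD(4)[OF E] sigma_ringD(3)[OF H B(1) decD(2)[OF E]]]) blast
    then show "B - B \<inter> A \<in> dom \<nu>" by (simp add: Diff_Int)
  qed simp
  have dec_Un: "dec (E \<union> F) (A \<union> B)" if E: "dec E A" and F: "dec F B" for E F A B
    unfolding dec_def
  proof (intro conjI)
    show "A \<union> B \<in> dom \<mu>" by (rule M(3)[OF decD(1)[OF E] decD(1)[OF F]])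
    show "A \<union> B \<subseteq> E \<union> F" using decD(3)[OF E] decD(3)[OF F] by blast
    have "(E \<union> F) - (A \<union> B) \<in> H"
      by (intro sigma_ringD(2,3)[OF H] decD(2)[OF E] decD(2)[OF F] decD(6)[OF E] decD(6)[OF F])
    then show "(E \<union> F) - (A \<union> B) \<in> dom \<nu>"
      by (rule N(4)[OF N(3)[OF decD(4)[OF E] decD(4)[OF F]]]) blast
  qed
  have ideal: "ideal_in H (dom \<rho>)"
    unfolding ideal_in_def
  proof (intro conjI ballI impI subsetI)
    have "dec {} {}" using M(2) N(2) by (simp add: dec_def)
    then show "{} \<in> dom \<rho>" unfolding dom by (rule exI)
    show "E \<in> H" if "E \<in> dom \<rho>" for E using that decD(6) unfolding dom by (elim exE)
    show "E \<union> F \<in> dom \<rho>" if "E \<in> dom \<rho>" "F \<in> dom \<rho>" for E F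
      using that dec_Un unfolding dom by (elim exE) (rule exI)
    show "F \<in> dom \<rho>" if "E \<in> dom \<rho>" "F \<in> H" "F \<subseteq> E" for E F
      using that(1) dec_sub[OF _ that(2,3)] unfolding dom by (elim exE) (rule exI)
  qed
  have "sigma_additive \<rho>"
    unfolding sigma_additive_def
  proof (intro ballI allI impI, elim conjE)
    fix E and I :: "nat set" and P :: "nat \<Rightarrow> 'b set"
    assume E: "E \<in> dom \<rho>" and P: "P ` I \<subseteq> dom \<rho>" "disjoint_family_on P I" "(\<Union>i\<in>I. P i) = E"
    obtain A where A: "dec E A" using E dom by blast
    have PH: "P i \<in> H" "P i \<subseteq> E" if "i \<in> I" for i
      using that P ideal_inD(1)[OF ideal] by auto
    \<comment> \<open>All members of the partition are cut by the same \<open>A\<close>, so the sum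
      separates into one for \<open>\<mu>\<close> and one for \<open>\<nu>\<close>.\<close>
    have d: "dec (P i) (P i \<inter> A)" if "i \<in> I" for i
      using dec_sub[OF A PH[OF that]] .
    have U: "(\<Union>i\<in>I. P i \<inter> A) = A" "(\<Union>i\<in>I. P i - A) = E - A"
      using A P(3) unfolding dec_def by auto
    have eqd: "P i - P i \<inter> A = P i - A" for i by auto
    have dj: "disjoint_family_on (\<lambda>i. P i \<inter> A) I" "disjoint_family_on (\<lambda>i. P i - A) I"
      using P(2) unfolding disjoint_family_on_def by blast+
    have "((\<lambda>i. the (\<mu> (P i \<inter> A))) has_sum the (\<mu> (\<Union>i\<in>I. P i \<inter> A))) I"
      by (rule sigma_additiveD[OF \<mu>(1) decD(1)[OF d] dj(1)]) (simp_all only: U decD(1)[OF A])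
    moreover have "((\<lambda>i. the (\<nu> (P i - A))) has_sum the (\<nu> (\<Union>i\<in>I. P i - A))) I"
      by (rule sigma_additiveD[OF \<nu>(1) decD(4)[OF d, unfolded eqd] dj(2)]) (simp_all only: U decD(4)[OF A])
    ultimately have "((\<lambda>i. the (\<mu> (P i \<inter> A)) + the (\<nu> (P i - A))) has_sum
        (the (\<mu> A) + the (\<nu> (E - A)))) I"
      unfolding U by (rule has_sum_add)
    moreover have "the (\<mu> (P i \<inter> A)) + the (\<nu> (P i - A)) = the (\<rho> (P i))" if "i \<in> I" for i
      using val[OF d[OF that]] eqd by simp
    ultimately show "((\<lambda>i. the (\<rho> (P i))) has_sum the (\<rho> E)) I"
      unfolding val[OF A] option.sel by (rule has_sum_cong[THEN iffD1, rotated])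
  qed
  moreover have "\<mu> \<subseteq>\<^sub>m \<rho>"
    unfolding map_le_def
  proof
    fix E assume E: "E \<in> dom \<mu>"
    then have "dec E E" using N(2) unfolding dec_def by simp
    then show "\<mu> E = \<rho> E"
      using val domD[OF E] sigma_additive_empty[OF \<nu>(1) N(2)] by fastforce
  qed
  moreover have "\<nu> \<subseteq>\<^sub>m \<rho>"
    unfolding map_le_def
  proof
    fix E assume E: "E \<in> dom \<nu>"
    then have "dec E {}" using M(2) unfolding dec_def by simp
    then show "\<nu> E = \<rho> E"
      using val domD[OF E] sigma_additive_empty[OF \<mu>(1) M(2)] by fastforce
  qed
  ultimately show ?thesis using that ideal by blast
qed

text \<open>Directedness serves the closure under binary unions. Additivity at \<open>E\<close>
  takes place inside a single member of \<open>F\<close>, because an ideal containing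
  \<open>E\<close> contains all parts of \<open>E\<close> that lie in \<open>H\<close>.\<close>

lemma sigma_additive_Union:
  fixes F :: "('b set \<rightharpoonup> 'a::{topological_ab_group_add, t2_space}) set"
  assumes F: "\<And>f. f \<in> F \<Longrightarrow> sigma_additive f" "\<And>f. f \<in> F \<Longrightarrow> ideal_in H (dom f)" "F \<noteq> {}"
    and eq: "\<And>f g E. f \<in> F \<Longrightarrow> g \<in> F \<Longrightarrow> E \<in> dom f \<Longrightarrow> E \<in> dom g \<Longrightarrow> f E = g E"
    and dir: "\<And>f g. f \<in> F \<Longrightarrow> g \<in> F \<Longrightarrow> \<exists>h\<in>F. dom f \<subseteq> dom h \<and> dom g \<subseteq> dom h"
  obtains \<rho> where "sigma_additive \<rho>" "ideal_in H (dom \<rho>)" "dom \<rho> = (\<Union>f\<in>F. dom f)"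
    "\<And>f. f \<in> F \<Longrightarrow> f \<subseteq>\<^sub>m \<rho>"
proof -
  define \<rho> where "\<rho> E = (if \<exists>f\<in>F. E \<in> dom f then (SOME f. f \<in> F \<and> E \<in> dom f) E else None)" for E
  have val: "\<rho> E = f E" if "f \<in> F" "E \<in> dom f" for f E
  proof -
    have "(SOME f. f \<in> F \<and> E \<in> dom f) \<in> F \<and> E \<in> dom (SOME f. f \<in> F \<and> E \<in> dom f)"
      using that by (intro someI[of "\<lambda>f. f \<in> F \<and> E \<in> dom f"]) simp
    then show ?thesis using eq that unfolding \<rho>_def by (smt (verit, best))
  qed
  have dom: "dom \<rho> = (\<Union>f\<in>F. dom f)"
  proof
    show "dom \<rho> \<subseteq> (\<Union>f\<in>F. dom f)" unfolding \<rho>_def by (auto simp: domIff split: if_splits)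
    show "(\<Union>f\<in>F. dom f) \<subseteq> dom \<rho>" using val by (auto simp: domIff)
  qed
  have ideal: "ideal_in H (dom \<rho>)"
    unfolding ideal_in_def dom
  proof (intro conjI ballI impI)
    show "(\<Union>f\<in>F. dom f) \<subseteq> H" using ideal_inD(1)[OF F(2)] by blast
    show "{} \<in> (\<Union>f\<in>F. dom f)" using ideal_inD(2)[OF F(2)] F(3) by blast
    show "A \<union> B \<in> (\<Union>f\<in>F. dom f)" if "A \<in> (\<Union>f\<in>F. dom f)" "B \<in> (\<Union>f\<in>F. dom f)" for A B
    proof -
      obtain f g where fg: "f \<in> F" "g \<in> F" "A \<in> dom f" "B \<in> dom g" using \<open>A \<in> _\<close> \<open>B \<in> _\<close> by blast
      then obtain h where "h \<in> F" "A \<in> dom h" "B \<in> dom h" using dir[of f g] by blast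
      then show ?thesis using ideal_inD(3)[OF F(2)] by blast
    qed
    show "B \<in> (\<Union>f\<in>F. dom f)" if "A \<in> (\<Union>f\<in>F. dom f)" "B \<in> H" "B \<subseteq> A" for A B
    proof -
      obtain f where "f \<in> F" "A \<in> dom f" using \<open>A \<in> _\<close> by blast
      then show ?thesis using ideal_inD(4)[OF F(2)] \<open>B \<in> H\<close> \<open>B \<subseteq> A\<close> by blast
    qed
  qed
  have "sigma_additive \<rho>"
    unfolding sigma_additive_def
  proof (intro ballI allI impI, elim conjE)
    fix E and I :: "nat set" and P :: "nat \<Rightarrow> 'b set"
    assume E: "E \<in> dom \<rho>" and P: "P ` I \<subseteq> dom \<rho>" "disjoint_family_on P I" "(\<Union>i\<in>I. P i) = E"
    obtain f where f: "f \<in> F" "E \<in> dom f" using E dom by blast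
    have Pf: "P i \<in> dom f" if "i \<in> I" for i
    proof (rule ideal_inD(4)[OF F(2)[OF f(1)] f(2)])
      show "P i \<in> H" using that P(1) ideal_inD(1)[OF ideal] by blast
      show "P i \<subseteq> E" using that P(3) by blast
    qed
    have "((\<lambda>i. the (f (P i))) has_sum the (f (\<Union>i\<in>I. P i))) I"
      using f(2) P(2,3) by (intro sigma_additiveD F(1)[OF f(1)] Pf) simp_all
    moreover have "the (f (P i)) = the (\<rho> (P i))" if "i \<in> I" for i
      using val[OF f(1) Pf[OF that]] by simp
    ultimately show "((\<lambda>i. the (\<rho> (P i))) has_sum the (\<rho> E)) I"
      unfolding P(3) val[OF f] by (rule has_sum_cong[THEN iffD1, rotated])
  qed
  moreover have "f \<subseteq>\<^sub>m \<rho>" if "f \<in> F" for f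
    using val[OF that] unfolding map_le_def by simp
  ultimately show ?thesis using that ideal dom by blast
qed

section \<open>Similarity of premeasures and maximal extensions\<close>

lemma similar_sym: "\<mu> \<asymp> \<nu> \<Longrightarrow> \<nu> \<asymp> \<mu>"
  unfolding similar_def by auto

lemma extension_similar:
  assumes "\<mu> \<subseteq>\<^sub>m \<nu>" "dom \<nu> \<subseteq> host \<mu>"
  shows "\<nu> \<asymp> \<mu>"
  using assms host_eqI[of \<mu> \<nu>] map_le_implies_dom_le[OF assms(1)]
  unfolding similar_def map_le_def by auto

text \<open>A set in the domains of \<open>\<mu>\<close> and \<open>\<nu>\<close> may be missing
  from that of \<open>\<kappa>\<close>. As the hosts coincide, countably many sets of
  \<open>dom \<kappa>\<close> cover it, and its traces on them lie in all three domains.\<close>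

lemma similar_trans:
  fixes \<mu> \<kappa> \<nu> :: "'b set \<rightharpoonup> 'a::{topological_ab_group_add, t2_space}"
  assumes pre: "premeasure \<mu>" "premeasure \<kappa>" "premeasure \<nu>"
    and sim: "\<mu> \<asymp> \<kappa>" "\<kappa> \<asymp> \<nu>"
  shows "\<mu> \<asymp> \<nu>"
  unfolding similar_def
proof (intro conjI ballI)
  have h: "host \<mu> = host \<kappa>" "host \<nu> = host \<kappa>"
    using sim unfolding similar_def by auto
  then show "host \<mu> = host \<nu>" by simp
  fix E assume E: "E \<in> dom \<mu> \<inter> dom \<nu>"
  have R: "ring_of_sets UNIV (dom \<kappa>)"
    using pre(2) unfolding premeasure_def delta_ring_def by blast
  have add: "sigma_additive \<mu>" "sigma_additive \<nu>"
    using pre unfolding premeasure_def by auto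
  have ideal: "ideal_in (host \<kappa>) (dom \<kappa>)" "ideal_in (host \<kappa>) (dom \<mu>)" "ideal_in (host \<kappa>) (dom \<nu>)"
    using premeasure_ideal pre h by metis+
  note H = sigma_ring_host[of \<kappa>]
  have EH: "E \<in> host \<kappa>" using E ideal_inD(1)[OF ideal(2)] by blast
  obtain C :: "nat \<Rightarrow> 'b set" where C: "range C \<subseteq> dom \<kappa>" "E \<subseteq> (\<Union>n. C n)"
    using hull_covered[OF ideal_inD(2)[OF ideal(1)]] EH unfolding host_def by metis
  have D: "E \<inter> C n \<in> dom \<kappa>" "E \<inter> C n \<in> dom \<mu>" "E \<inter> C n \<in> dom \<nu>" for n
  proof -
    have "C n \<in> dom \<kappa>" using C(1) by blast
    moreover from this have "C n \<in> host \<kappa>" using dom_subset_host by blast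
    ultimately show "E \<inter> C n \<in> dom \<kappa>" "E \<inter> C n \<in> dom \<mu>" "E \<inter> C n \<in> dom \<nu>"
      using E by (auto intro: ideal_in_Int(2)[OF ideal(1) H _ EH] ideal_in_Int(1)[OF ideal(2) H]
        ideal_in_Int(1)[OF ideal(3) H])
  qed
  show "\<mu> E = \<nu> E"
  proof (rule sigma_additive_agree[OF R add(1) _ add(2)])
    show "ideal_in (sigma_ring hull dom \<kappa>) (dom \<mu>)" "ideal_in (sigma_ring hull dom \<kappa>) (dom \<nu>)"
      using ideal unfolding host_def by auto
    show "\<mu> F = \<nu> F" if "F \<in> dom \<kappa>" "F \<in> dom \<mu>" "F \<in> dom \<nu>" for F
      using sim that unfolding similar_def by auto
    show "range (\<lambda>n. E \<inter> C n) \<subseteq> dom \<kappa>" "range (\<lambda>n. E \<inter> C n) \<subseteq> dom \<mu>" "range (\<lambda>n. E \<inter> C n) \<subseteq> dom \<nu>"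
      using D by blast+
    show "E \<in> dom \<mu>" "E \<in> dom \<nu>" using E by auto
    show "E \<subseteq> (\<Union>n. E \<inter> C n)" using C(2) by blast
  qed
qed

text \<open>Any two premeasures similar to a given one have a common extension similar to it, so the
  union of all of them is again a premeasure.\<close>

lemma premeasure_maximal:
  assumes pre: "premeasure \<mu>"
  obtains \<nu> where "group_measure \<nu>" "\<mu> \<subseteq>\<^sub>m \<nu>" "host \<nu> = host \<mu>"
proof -
  let ?F = "{f. premeasure f \<and> f \<asymp> \<mu>}"
  note H = sigma_ring_host[of \<mu>]
  have \<mu>F: "\<mu> \<in> ?F" using pre by (simp add: similar_def)
  have add: "sigma_additive f" if "f \<in> ?F" for f
    using that unfolding premeasure_def by blast
  have ideal: "ideal_in (host \<mu>) (dom f)" if "f \<in> ?F" for f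
    using premeasure_ideal[of f] that unfolding similar_def by simp
  have sim: "f \<asymp> g" if "f \<in> ?F" "g \<in> ?F" for f g
    using that pre similar_trans similar_sym by blast
  then have eq: "f E = g E" if "f \<in> ?F" "g \<in> ?F" "E \<in> dom f" "E \<in> dom g" for f g E
    using that unfolding similar_def by blast
  have dir: "\<exists>h\<in>?F. dom f \<subseteq> dom h \<and> dom g \<subseteq> dom h" if fg: "f \<in> ?F" "g \<in> ?F" for f g
  proof -
    obtain \<rho> where \<rho>: "sigma_additive \<rho>" "ideal_in (host \<mu>) (dom \<rho>)" "f \<subseteq>\<^sub>m \<rho>" "g \<subseteq>\<^sub>m \<rho>"
      using sigma_additive_join[OF H add[OF fg(1)] ideal[OF fg(1)] add[OF fg(2)] ideal[OF fg(2)] eq[OF fg]] by blast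
    have "premeasure \<rho>" using ideal_premeasure[OF H \<rho>(2,1)] .
    \<comment> \<open>The join extends \<open>f\<close> within the common host, so it is similar to
      \<open>f\<close> and, by transitivity, to \<open>\<mu>\<close>.\<close>
    moreover have "\<rho> \<asymp> f"
      using \<rho>(2) fg(1) by (intro extension_similar \<rho>) (auto simp: similar_def dest: ideal_inD(1))
    ultimately have "\<rho> \<in> ?F"
      using similar_trans[of \<rho> f \<mu>] fg(1) pre by simp
    then show ?thesis using map_le_implies_dom_le \<rho>(3,4) by blast
  qed
  obtain \<nu> where \<nu>: "sigma_additive \<nu>" "ideal_in (host \<mu>) (dom \<nu>)" "\<And>f. f \<in> ?F \<Longrightarrow> f \<subseteq>\<^sub>m \<nu>"
    using sigma_additive_Union[of ?F "host \<mu>"] add ideal eq dir \<mu>F by (smt (verit) empty_iff)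
  have p\<nu>: "premeasure \<nu>" using ideal_premeasure[OF H \<nu>(2,1)] .
  have s: "\<nu> \<asymp> \<mu>"
    using \<nu>(3)[OF \<mu>F] ideal_inD(1)[OF \<nu>(2)] by (rule extension_similar)
  \<comment> \<open>A premeasure similar to \<open>\<nu>\<close> is similar to \<open>\<mu>\<close>
    by transitivity, hence already a member of the family.\<close>
  have "group_measure \<nu>"
    unfolding group_measure_def
    using p\<nu> \<nu>(3) similar_trans[OF _ p\<nu> pre _ s] by blast
  then show ?thesis using that \<nu>(3)[OF \<mu>F] s unfolding similar_def by blast
qed

text \<open>Passage from partial maps to the locale and back: on the trace of
  \<open>dom \<mu>\<close> exhaustivity is unconditional, and by \<open>hull_trace\<close> the
  sigma-algebra generated there is the part of the host below \<open>A\<close>.\<close>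

lemma exhaustive_extension:
  fixes \<mu> :: "'b set \<rightharpoonup> 'a::{topological_ab_group_add, uniform_topological_group_add, t2_space}"
  assumes complete: "sequentially_complete TYPE('a)"
    and \<mu>: "sigma_content \<mu>"
    and A: "A \<in> countable_unions (dom \<mu>)" "exhaustive_on A \<mu>"
  obtains \<kappa> where "dom \<kappa> = {B \<in> host \<mu>. B \<subseteq> A}" "sigma_additive \<kappa>"
    "ideal_in (host \<mu>) (dom \<kappa>)" "\<And>B. B \<in> dom \<mu> \<Longrightarrow> B \<subseteq> A \<Longrightarrow> \<kappa> B = \<mu> B"
proof -
  let ?R = "dom \<mu> \<inter> Pow A"
  have R: "ring_of_sets UNIV (dom \<mu>)" and add: "sigma_additive \<mu>"
    using \<mu> unfolding sigma_content_def by auto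
  then have empty: "{} \<in> dom \<mu>" unfolding ring_of_sets_iff by blast
  obtain C :: "nat \<Rightarrow> 'b set" where C: "range C \<subseteq> dom \<mu>" "(\<Union>n. C n) = A"
    using countable_unionsE[OF A(1) empty] .
  have trace: "sigma_sets A ?R = {B \<in> host \<mu>. B \<subseteq> A}"
    unfolding host_def by (rule hull_trace[OF R C])
  interpret exhaustive_content A ?R "\<lambda>E. the (\<mu> E)"
  proof (rule exhaustive_content.intro)
    show "sequentially_complete TYPE('a)" by (rule complete)
    show "ring_of_sets A ?R" by (rule trace_ring[OF R])
    fix P :: "nat \<Rightarrow> 'b set"
    assume P: "range P \<subseteq> ?R" "disjoint_family P"
    have "P n \<in> dom \<mu>" for n using P(1) by blast
    then show "(\<lambda>n. the (\<mu> (P n))) sums the (\<mu> (\<Union>n. P n))" if "(\<Union>n. P n) \<in> ?R"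
      using that P(2) by (intro has_sum_imp_sums sigma_additiveD[OF add]) simp_all
    show "(\<lambda>n. the (\<mu> (P n))) \<longlonglongrightarrow> 0"
      using A(2) P unfolding exhaustive_on_def by blast
  next
    show "\<exists>C :: nat \<Rightarrow> 'b set. range C \<subseteq> ?R \<and> (\<Union>n. C n) = A"
      using C by (intro exI[of _ C]) auto
  qed
  obtain n where n: "\<And>E. E \<in> ?R \<Longrightarrow> n E = the (\<mu> E)"
    "\<And>(I :: nat set) P. P ` I \<subseteq> sigma_sets A ?R \<Longrightarrow> disjoint_family_on P I \<Longrightarrow>
       ((\<lambda>i. n (P i)) has_sum n (\<Union>i\<in>I. P i)) I"
    by (rule extension) (rule that)
  define \<kappa> where "\<kappa> E = (if E \<in> sigma_sets A ?R then Some (n E) else None)" for E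
  have dom: "dom \<kappa> = sigma_sets A ?R" by (auto simp: \<kappa>_def dom_def)
  show ?thesis
  proof (rule that[of \<kappa>])
    show "dom \<kappa> = {B \<in> host \<mu>. B \<subseteq> A}" unfolding dom by (rule trace)
    show "ideal_in (host \<mu>) (dom \<kappa>)"
      unfolding dom trace ideal_in_def using sigma_ringD(1,2)[OF sigma_ring_host[of \<mu>]] by auto
    show "\<kappa> B = \<mu> B" if "B \<in> dom \<mu>" "B \<subseteq> A" for B
      using that n(1)[of B] domD[OF that(1)] unfolding \<kappa>_def by (auto intro: sigma_sets.Basic)
    show "sigma_additive \<kappa>"
      unfolding sigma_additive_def dom
    proof (intro ballI allI impI, elim conjE)
      fix E and I :: "nat set" and P :: "nat \<Rightarrow> 'b set"
      assume E: "E \<in> sigma_sets A ?R" "P ` I \<subseteq> sigma_sets A ?R" "disjoint_family_on P I" "(\<Union>i\<in>I. P i) = E"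
      have \<kappa>: "the (\<kappa> F) = n F" if "F \<in> sigma_sets A ?R" for F
        using that by (simp add: \<kappa>_def)
      have "n (P i) = the (\<kappa> (P i))" if "i \<in> I" for i
        using E(2) that by (simp add: image_subset_iff \<kappa>)
      then show "((\<lambda>i. the (\<kappa> (P i))) has_sum the (\<kappa> E)) I"
        using n(2)[OF E(2,3)] unfolding \<kappa>[OF E(1)] E(4) by (rule has_sum_cong[THEN iffD1])
    qed
  qed
qed

subsection \<open>Weakly exhaustive contents\<close>

lemma mem_countable_unions: "A \<in> K \<Longrightarrow> A \<in> countable_unions K"
  unfolding countable_unions_def by (intro CollectI exI[of _ "{A}"]) simp

text \<open>Moves the content from a ring to an ideal of its host, where the gluing lemmas apply.
  The extensions below single ring sets agree by uniqueness and are directed because a ring is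
  closed under unions.\<close>

lemma weakly_exhaustive_extension:
  fixes \<mu> :: "'b set \<rightharpoonup> 'a::{topological_ab_group_add, uniform_topological_group_add, t2_space}"
  assumes complete: "sequentially_complete TYPE('a)"
    and \<mu>: "sigma_content \<mu>" and exh: "weakly_exhaustive \<mu>"
  obtains \<kappa> where "sigma_additive \<kappa>" "ideal_in (host \<mu>) (dom \<kappa>)" "\<mu> \<subseteq>\<^sub>m \<kappa>"
proof -
  have R: "ring_of_sets UNIV (dom \<mu>)"
    using \<mu> unfolding sigma_content_def by blast
  then have empty: "{} \<in> dom \<mu>" and Un: "\<And>A B. A \<in> dom \<mu> \<Longrightarrow> B \<in> dom \<mu> \<Longrightarrow> A \<union> B \<in> dom \<mu>"
    unfolding ring_of_sets_iff by blast+
  note DH = dom_subset_host[of \<mu>]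
  define ext where "ext A f \<longleftrightarrow> dom f = {B \<in> host \<mu>. B \<subseteq> A} \<and> sigma_additive f \<and>
    ideal_in (host \<mu>) (dom f) \<and> (\<forall>B\<in>dom \<mu>. B \<subseteq> A \<longrightarrow> f B = \<mu> B)" for A f
  have extD: "dom f = {B \<in> host \<mu>. B \<subseteq> A}" "sigma_additive f" "ideal_in (host \<mu>) (dom f)"
    "\<And>B. B \<in> dom \<mu> \<Longrightarrow> B \<subseteq> A \<Longrightarrow> f B = \<mu> B" if "ext A f" for A f
    using that unfolding ext_def by blast+
  have ext: "\<exists>f. ext A f" if A: "A \<in> dom \<mu>" for A
  proof -
    have "exhaustive_on A \<mu>" using exh A unfolding weakly_exhaustive_def by blast
    then obtain f where "dom f = {B \<in> host \<mu>. B \<subseteq> A}" "sigma_additive f" "ideal_in (host \<mu>) (dom f)"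
      "\<And>B. B \<in> dom \<mu> \<Longrightarrow> B \<subseteq> A \<Longrightarrow> f B = \<mu> B"
      by (rule exhaustive_extension[OF complete \<mu> mem_countable_unions[OF A]]) (rule that)
    then show ?thesis unfolding ext_def by (intro exI[of _ f]) simp
  qed
  have eq: "f E = g E"
    if A: "A \<in> dom \<mu>" "ext A f" and B: "B \<in> dom \<mu>" "ext B g" and E: "E \<in> dom f" "E \<in> dom g" for A B f g E
  \<comment> \<open>A set in both domains lies below the ring set \<open>A \<inter> B\<close>, so a
    constant cover suffices.\<close>
  proof (rule sigma_additive_agree[OF R, of f g "\<lambda>_. A \<inter> B"])
    have AB: "A \<inter> B \<in> dom \<mu>" by (rule ring_of_sets_UNIV_Int[OF R A(1) B(1)])
    then have "A \<inter> B \<in> host \<mu>" using DH by blast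
    then show "range (\<lambda>_. A \<inter> B) \<subseteq> dom \<mu>" "range (\<lambda>_. A \<inter> B) \<subseteq> dom f" "range (\<lambda>_. A \<inter> B) \<subseteq> dom g"
      using AB by (simp_all add: extD(1)[OF A(2)] extD(1)[OF B(2)])
    show "sigma_additive f" "sigma_additive g" by (rule extD(2)[OF A(2)] extD(2)[OF B(2)])+
    show "ideal_in (sigma_ring hull dom \<mu>) (dom f)" "ideal_in (sigma_ring hull dom \<mu>) (dom g)"
      using extD(3)[OF A(2)] extD(3)[OF B(2)] unfolding host_def by simp_all
    show "E \<subseteq> (\<Union>n::nat. A \<inter> B)"
      using E by (simp add: extD(1)[OF A(2)] extD(1)[OF B(2)])
    show "f F = g F" if "F \<in> dom \<mu>" "F \<in> dom f" "F \<in> dom g" for F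
      using that extD(4)[OF A(2) that(1)] extD(4)[OF B(2) that(1)]
      by (simp add: extD(1)[OF A(2)] extD(1)[OF B(2)])
  qed (use E in simp_all)
  let ?F = "{f. \<exists>A\<in>dom \<mu>. ext A f}"
  obtain \<kappa> where \<kappa>: "sigma_additive \<kappa>" "ideal_in (host \<mu>) (dom \<kappa>)" "\<And>f. f \<in> ?F \<Longrightarrow> f \<subseteq>\<^sub>m \<kappa>"
  proof (rule sigma_additive_Union[of ?F "host \<mu>"])
    show "sigma_additive f" "ideal_in (host \<mu>) (dom f)" if "f \<in> ?F" for f
      using that extD(2,3) by blast+
    show "?F \<noteq> {}" using ext[OF empty] empty by blast
    show "f E = g E" if "f \<in> ?F" "g \<in> ?F" "E \<in> dom f" "E \<in> dom g" for f g E
      using that eq by blast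
    show "\<exists>h\<in>?F. dom f \<subseteq> dom h \<and> dom g \<subseteq> dom h" if fg: "f \<in> ?F" "g \<in> ?F" for f g
    proof -
      obtain A B where AB: "A \<in> dom \<mu>" "B \<in> dom \<mu>" "ext A f" "ext B g" using fg by blast
      obtain h where h: "ext (A \<union> B) h" using ext[OF Un[OF AB(1,2)]] ..
      have "dom f \<subseteq> dom h \<and> dom g \<subseteq> dom h"
        unfolding extD(1)[OF h] extD(1)[OF AB(3)] extD(1)[OF AB(4)] by blast
      then show ?thesis using h Un[OF AB(1,2)] by blast
    qed
  qed (rule that)
  have \<mu>\<kappa>: "\<mu> \<subseteq>\<^sub>m \<kappa>"
    unfolding map_le_def
  proof
    fix E assume E: "E \<in> dom \<mu>"
    then obtain f where f: "ext E f" using ext by blast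
    then have "f \<subseteq>\<^sub>m \<kappa>" using E by (intro \<kappa>(3)) blast
    moreover have "E \<in> dom f" using E DH unfolding extD(1)[OF f] by blast
    ultimately show "\<mu> E = \<kappa> E" using extD(4)[OF f E] unfolding map_le_def by simp
  qed
  show ?thesis by (rule that[OF \<kappa>(1,2) \<mu>\<kappa>])
qed

theorem theorem10p7:
  fixes \<mu> :: "'b set \<rightharpoonup> 'a::{topological_ab_group_add, uniform_topological_group_add, t2_space}"
  assumes "sequentially_complete TYPE('a)"
    and "sigma_content \<mu>"
    and "weakly_exhaustive \<mu>"
  shows "(\<exists>!\<nu>. measure_extension \<mu> \<nu>) \<and>
         (\<forall>\<nu>. measure_extension \<mu> \<nu> \<longrightarrow>
            dom \<mu> \<subseteq> exhaustive_sets \<mu> \<and> exhaustive_sets \<mu> \<subseteq> dom \<nu>)"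
proof -
  have R: "ring_of_sets UNIV (dom \<mu>)" and add\<mu>: "sigma_additive \<mu>"
    using assms(2) unfolding sigma_content_def by auto
  then have empty: "{} \<in> dom \<mu>"
    unfolding ring_of_sets_iff by blast
  note H = sigma_ring_host[of \<mu>]
  note DH = dom_subset_host[of \<mu>]
  obtain \<kappa> where \<kappa>: "sigma_additive \<kappa>" "ideal_in (host \<mu>) (dom \<kappa>)" and \<mu>\<kappa>: "\<mu> \<subseteq>\<^sub>m \<kappa>"
    using weakly_exhaustive_extension[OF assms] .
  \<comment> \<open>Extending to \<open>\<kappa>\<close> does not enlarge the host, so a measure
    with the host of \<open>\<kappa>\<close> stays within \<open>host \<mu>\<close>.\<close>
  have hl: "host \<kappa> = host \<mu>"
    using map_le_implies_dom_le[OF \<mu>\<kappa>] ideal_inD(1)[OF \<kappa>(2)] by (rule host_eqI)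
  obtain \<nu> where \<nu>: "group_measure \<nu>" "\<kappa> \<subseteq>\<^sub>m \<nu>" "host \<nu> = host \<kappa>"
    using premeasure_maximal[OF ideal_premeasure[OF H \<kappa>(2,1)]] .
  have \<mu>\<nu>: "\<mu> \<subseteq>\<^sub>m \<nu>" using \<mu>\<kappa> \<nu>(2) by (rule map_le_trans)
  have restr: "\<mu> = \<nu>' |` dom \<mu> \<longleftrightarrow> \<mu> \<subseteq>\<^sub>m \<nu>'" for \<nu>'
    unfolding map_le_def fun_eq_iff restrict_map_def by (metis domIff)
  have "measure_extension \<mu> \<nu>"
    unfolding measure_extension_def restr
    using \<nu>(1) \<mu>\<nu> map_le_implies_dom_le[OF \<mu>\<nu>] dom_subset_host[of \<nu>] \<nu>(3) hl by simp

  have ext_props: "premeasure \<nu>" "sigma_additive \<nu>" "host \<nu> = host \<mu>" "ideal_in (host \<mu>) (dom \<nu>)" "\<mu> \<subseteq>\<^sub>m \<nu>"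
    if "measure_extension \<mu> \<nu>" for \<nu>
  proof -
    show p: "premeasure \<nu>" and "sigma_additive \<nu>"
      using that unfolding measure_extension_def group_measure_def premeasure_def by auto
    show h: "host \<nu> = host \<mu>"
      using that host_eqI unfolding measure_extension_def by blast
    show "ideal_in (host \<mu>) (dom \<nu>)" using premeasure_ideal[OF p] h by simp
    show "\<mu> \<subseteq>\<^sub>m \<nu>" using that unfolding measure_extension_def restr by blast
  qed
  \<comment> \<open>Applied twice: with \<open>f\<close> a second measure extension, for uniqueness,
    and with \<open>f\<close> the extension below an exhaustive set, for the last inclusion.\<close>
  have agree: "\<nu> E = f E"
    if \<nu>: "measure_extension \<mu> \<nu>" and f: "sigma_additive f" "ideal_in (host \<mu>) (dom f)"
      "\<And>B. B \<in> dom \<mu> \<Longrightarrow> B \<in> dom f \<Longrightarrow> f B = \<mu> B"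
    and C: "range C \<subseteq> dom \<mu>" "range C \<subseteq> dom f" "E \<subseteq> (\<Union>n. C n)" and E: "E \<in> dom \<nu>" "E \<in> dom f"
    for \<nu> f E and C :: "nat \<Rightarrow> 'b set"
  proof (rule sigma_additive_agree[OF R ext_props(2)[OF \<nu>] _ f(1)])
    note e = ext_props[OF \<nu>]
    show "ideal_in (sigma_ring hull dom \<mu>) (dom \<nu>)" "ideal_in (sigma_ring hull dom \<mu>) (dom f)"
      using e(4) f(2) unfolding host_def by auto
    show "range C \<subseteq> dom \<nu>" using C(1) map_le_implies_dom_le[OF e(5)] by blast
    show "\<nu> F = f F" if "F \<in> dom \<mu>" "F \<in> dom \<nu>" "F \<in> dom f" for F
      using f(3) e(5) that unfolding map_le_def by simp
  qed (use C E in auto)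

  have unique: "\<nu> = \<nu>'" if \<nu>: "measure_extension \<mu> \<nu>" "measure_extension \<mu> \<nu>'" for \<nu> \<nu>'
  proof -
    note e = ext_props[OF \<nu>(1)] and e' = ext_props[OF \<nu>(2)]
    have "\<nu> \<asymp> \<nu>'"
      unfolding similar_def
    proof (intro conjI ballI)
      show "host \<nu> = host \<nu>'" using e e' by simp
      fix E assume E: "E \<in> dom \<nu> \<inter> dom \<nu>'"
      then have "E \<in> sigma_ring hull dom \<mu>" using ideal_inD(1)[OF e(4)] unfolding host_def by blast
      from hull_covered[OF empty this] obtain C :: "nat \<Rightarrow> 'b set"
        where C: "range C \<subseteq> dom \<mu>" "E \<subseteq> (\<Union>n. C n)" .
      show "\<nu> E = \<nu>' E"
      proof (rule agree[OF \<nu>(1) e'(2,4) _ C(1) _ C(2)])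
        show "\<nu>' B = \<mu> B" if "B \<in> dom \<mu>" for B using e'(5) that unfolding map_le_def by simp
        show "range C \<subseteq> dom \<nu>'" using C(1) map_le_implies_dom_le[OF e'(5)] by blast
      qed (use E in auto)
    qed
    \<comment> \<open>A measure extends every premeasure similar to it, so each of the two extends
      the other.\<close>
    then have "\<nu>' \<subseteq>\<^sub>m \<nu>" "\<nu> \<subseteq>\<^sub>m \<nu>'"
      using \<nu> e(1) e'(1) similar_sym unfolding measure_extension_def group_measure_def by blast+
    then show ?thesis by (rule map_le_antisym[rotated])
  qed

  have "dom \<mu> \<subseteq> exhaustive_sets \<mu>"
  proof
    fix A assume A: "A \<in> dom \<mu>"
    then have "exhaustive_on A \<mu>" using assms(3) unfolding weakly_exhaustive_def by blast
    then show "A \<in> exhaustive_sets \<mu>"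
      unfolding exhaustive_sets_def using A DH mem_countable_unions[OF A] by blast
  qed
  moreover have "exhaustive_sets \<mu> \<subseteq> dom \<nu>" if \<nu>: "measure_extension \<mu> \<nu>" for \<nu>
  proof
    note e = ext_props[OF \<nu>]
    fix B assume "B \<in> exhaustive_sets \<mu>"
    then obtain A where A: "A \<in> countable_unions (dom \<mu>)" "exhaustive_on A \<mu>" and B: "B \<in> host \<mu>" "B \<subseteq> A"
      unfolding exhaustive_sets_def by blast
    obtain \<kappa> where \<kappa>: "dom \<kappa> = {B \<in> host \<mu>. B \<subseteq> A}" "sigma_additive \<kappa>"
      "ideal_in (host \<mu>) (dom \<kappa>)" "\<And>B. B \<in> dom \<mu> \<Longrightarrow> B \<subseteq> A \<Longrightarrow> \<kappa> B = \<mu> B"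
      by (rule exhaustive_extension[OF assms(1,2) A]) (rule that)
    obtain C :: "nat \<Rightarrow> 'b set" where C: "range C \<subseteq> dom \<mu>" "(\<Union>n. C n) = A"
      using countable_unionsE[OF A(1) empty] .
    have "range C \<subseteq> dom \<kappa>"
      using C DH unfolding \<kappa>(1) by auto
    \<comment> \<open>\<open>C\<close> covers \<open>A\<close> and therefore every set of
      \<open>dom \<kappa>\<close>.\<close>
    then have eq: "\<nu> E = \<kappa> E" if "E \<in> dom \<nu>" "E \<in> dom \<kappa>" for E
      using that \<kappa>(1,4) C by (intro agree[OF \<nu> \<kappa>(2,3) _ C(1)]) auto
    obtain \<rho> where \<rho>: "sigma_additive \<rho>" "ideal_in (host \<mu>) (dom \<rho>)" "\<nu> \<subseteq>\<^sub>m \<rho>" "\<kappa> \<subseteq>\<^sub>m \<rho>"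
      using sigma_additive_join[OF H e(2,4) \<kappa>(2,3) eq] .
    \<comment> \<open>Maximality is applied to the join: it is a premeasure similar to
      \<open>\<nu>\<close>, so \<open>\<nu>\<close> already extends it and has \<open>B\<close> in
      its domain.\<close>
    have "\<rho> \<asymp> \<nu>"
      using ideal_inD(1)[OF \<rho>(2)] e(3) by (intro extension_similar \<rho>(3)) simp
    then have "\<rho> \<subseteq>\<^sub>m \<nu>"
      using \<nu> ideal_premeasure[OF H \<rho>(2,1)] unfolding measure_extension_def group_measure_def by blast
    moreover have "B \<in> dom \<rho>"
      using map_le_implies_dom_le[OF \<rho>(4)] B \<kappa>(1) by blast
    ultimately show "B \<in> dom \<nu>" using map_le_implies_dom_le by blast
  qed
  ultimately show ?thesis
    using \<open>measure_extension \<mu> \<nu>\<close> unique by blast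
qed

end
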